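(* Let $K$ be an infinite field with $\mathrm{char}(K)\neq 2$, and let $T_{\mathrm{Cla}}(UJ_2)\subseteq J(X)$ be the set of all $\mathbb{Z}_2$-graded polynomial identities of $UJ_2=UJ_2(K)$ endowed with the classical grading. Let $I$ be the $T_{\mathbb{Z}_2}$-ideal of $J(X)$ generated by the polynomials \[(y_1,y_2,y_3),\quad z_1z_2,\quad (y_1,z_1,y_2).\] Then $I=T_{\mathrm{Cla}}(UJ_2)$. Moreover, let $S\subseteq J(X)$ be the set of all polynomials of the forms (a) $Y'$, (b) $Y'(z_iY'')$, where $i\geq 1$; $Y'=y_{i_1}\cdots y_{i_r}$ with $r\geq 0$ and $i_1\leq\cdots\leq i_r$; $Y''=y_{j_1}\cdots y_{j_s}$ with $s\geq 0$ and $j_1\leq\cdots\leq j_s$; and $Y'\leq Y''$ in (b). Then the elements $g+I$, $g\in S$, form a basis of the quotient vector space $J(X)/I$.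
   Context: $UT_2(K)$ is the associative algebra of $2\times 2$ upper triangular matrices over $K$ with usual product $\cdot$, and $UJ_2=UJ_2(K)$ is the same vector space with the Jordan product $u\circ v=\frac12(u\cdot v+v\cdot u)$, written $uv$. A $\mathbb{Z}_2$-grading is a decomposition $UJ_2=(UJ_2)_0\oplus (UJ_2)_1$ with $(UJ_2)_i\circ(UJ_2)_j\subseteq (UJ_2)_{i+j}$. The classical grading is $(UJ_2)_0=\mathrm{span}\{e_{11}+e_{22},e_{11}-e_{22}\}$, $(UJ_2)_1=\mathrm{span}\{e_{12}\}$, where $e_{ij}$ are matrix units. $Y=\{y_1,y_2,\ldots\}$ and $Z=\{z_1,z_2,\ldots\}$ are disjoint infinite sets, $X=Y\cup Z$, and $J(X)$ is the free (unital) Jordan algebra over $K$ freely generated by $X$, with the $\mathbb{Z}_2$-grading in which each $y_i$ is even (degree $0$), each $z_i$ is odd (degree $1$), and the degree of a product of monomials is the sum of the degrees modulo $2$. A $T_{\mathbb{Z}_2}$-ideal is an ideal of $J(X)$ closed under all $\mathbb{Z}_2$-graded endomorphisms of $J(X)$; the $T_{\mathbb{Z}_2}$-ideal generated by a set is the smallest one containing it. An element $f(y_1,\ldots,y_s,z_1,\ldots,z_n)\in J(X)$ is a $\mathbb{Z}_2$-graded polynomial identity of $UJ_2$ if it vanishes under all substitutions of elements of $(UJ_2)_0$ for the $y_i$ and of elements of $(UJ_2)_1$ for the $z_i$. Associator: $(u,v,w)=(uv)w-u(vw)$. Products without parentheses are left-normed: $f_1f_2\cdots f_n=(f_1\cdots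 f_{n-1})f_n$; the empty product is $1$. Order: for monomials $Y'=y_{i_1}\cdots y_{i_r}$ and $Y''=y_{j_1}\cdots y_{j_s}$ with $r,s\geq 0$, $i_1\leq\cdots\leq i_r$, $j_1\leq\cdots\leq j_s$, write $Y'<Y''$ if either $r<s$, or $r=s$ and for some $l$ one has $i_1=j_1,\ldots,i_l=j_l$ and $i_{l+1}<j_{l+1}$; $Y'\leq Y''$ means $Y'<Y''$ or $Y'=Y''$. *)

theory Defs
  imports "HOL-Analysis.Analysis" "HOL-Library.Z2" "HOL.Hull"
begin

section \<open>Unital Jordan algebras\<close>

text \<open>Used over fields of characteristic different from 2.\<close>

locale unital_jordan_algebra = vector_space scale
  for scale :: "'k::field \<Rightarrow> 'a::ab_group_add \<Rightarrow> 'a" +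
  fixes mul :: "'a \<Rightarrow> 'a \<Rightarrow> 'a" and unit :: 'a
  assumes mul_commute: "mul x y = mul y x"
    and mul_add_left: "mul (x + y) z = mul x z + mul y z"
    and mul_scale_left: "mul (scale c x) y = scale c (mul x y)"
    and mul_unit: "mul unit x = x"
    and jordan: "mul (mul (mul x x) y) x = mul (mul x x) (mul y x)"


section \<open>The free unital Jordan algebra\<close>

text \<open>Variable number \<open>i\<close> stands for the variable with subscript \<open>i + 1\<close>: the variables
  \<open>y\<^sub>1, y\<^sub>2, \<dots>\<close> are \<open>Y 0, Y 1, \<dots>\<close>, and likewise for \<open>z\<^sub>1, z\<^sub>2, \<dots>\<close>.\<close>

datatype jvar = Y nat | Z nat

datatype 'k jterm =
    Var jvar
  | Zero
  | One
  | Add "'k jterm" "'k jterm"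
  | Scale 'k "'k jterm"
  | Mul "'k jterm" "'k jterm"

text \<open>The least congruence containing all instances of the laws of unital Jordan algebras; the
  quotient is therefore the free unital Jordan algebra on the variables (see
  \<open>free_jordan_universal\<close> below).\<close>

inductive jeq :: "'k::field jterm \<Rightarrow> 'k jterm \<Rightarrow> bool" where
  refl: "jeq s s"
| sym: "jeq s t \<Longrightarrow> jeq t s"
| trans: "jeq s t \<Longrightarrow> jeq t u \<Longrightarrow> jeq s u"
| Add: "jeq s s' \<Longrightarrow> jeq t t' \<Longrightarrow> jeq (Add s t) (Add s' t')"
| Scale: "jeq s s' \<Longrightarrow> jeq (Scale c s) (Scale c s')"
| Mul: "jeq s s' \<Longrightarrow> jeq t t' \<Longrightarrow> jeq (Mul s t) (Mul s' t')"
| add_assoc: "jeq (Add (Add s t) u) (Add s (Add t u))"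
| add_commute: "jeq (Add s t) (Add t s)"
| add_zero: "jeq (Add Zero s) s"
| add_neg: "jeq (Add (Scale (-1) s) s) Zero"
| scale_add: "jeq (Scale c (Add s t)) (Add (Scale c s) (Scale c t))"
| add_scale: "jeq (Scale (c + d) s) (Add (Scale c s) (Scale d s))"
| scale_scale: "jeq (Scale c (Scale d s)) (Scale (c * d) s)"
| scale_one: "jeq (Scale 1 s) s"
| mul_add: "jeq (Mul (Add s t) u) (Add (Mul s u) (Mul t u))"
| mul_scale: "jeq (Mul (Scale c s) t) (Scale c (Mul s t))"
| mul_one: "jeq (Mul One s) s"
| mul_commute: "jeq (Mul s t) (Mul t s)"
| jordan: "jeq (Mul (Mul (Mul s s) t) s) (Mul (Mul s s) (Mul t s))"

quotient_type (overloaded) 'k free_jordan = "'k::field jterm" / jeq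
  by (rule equivpI) (auto intro!: reflpI sympI transpI intro: jeq.refl jeq.sym jeq.trans)

instantiation free_jordan :: (field) "{ab_group_add, one, times}"
begin

lift_definition zero_free_jordan :: "'a free_jordan" is Zero .
lift_definition one_free_jordan :: "'a free_jordan" is One .
lift_definition plus_free_jordan :: "'a free_jordan \<Rightarrow> 'a free_jordan \<Rightarrow> 'a free_jordan" is Add
  by (rule jeq.Add)
lift_definition times_free_jordan :: "'a free_jordan \<Rightarrow> 'a free_jordan \<Rightarrow> 'a free_jordan" is Mul
  by (rule jeq.Mul)
lift_definition uminus_free_jordan :: "'a free_jordan \<Rightarrow> 'a free_jordan" is "Scale (-1)"
  by (rule jeq.Scale)
lift_definition minus_free_jordan :: "'a free_jordan \<Rightarrow> 'a free_jordan \<Rightarrow> 'a free_jordan"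
  is "\<lambda>s t. Add s (Scale (-1) t)"
  by (intro jeq.Add jeq.Scale)

instance
  by standard (transfer; auto intro: jeq.intros)+

end

lift_definition scaleJ :: "'k::field \<Rightarrow> 'k free_jordan \<Rightarrow> 'k free_jordan"  (infixr \<open>*\<^sub>J\<close> 75) is Scale
  by (rule jeq.Scale)

lift_definition var :: "jvar \<Rightarrow> 'k::field free_jordan" is Var .

abbreviation yv :: "nat \<Rightarrow> 'k::field free_jordan" where "yv i \<equiv> var (Y i)"
abbreviation zv :: "nat \<Rightarrow> 'k::field free_jordan" where "zv i \<equiv> var (Z i)"

global_interpretation FJ: unital_jordan_algebra scaleJ "(*)" "1 :: 'k::field free_jordan"
  by standard (transfer; auto intro: jeq.intros)+


subsection \<open>Substitution and the universal property\<close>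

primrec term_eval ::
  "('k::field \<Rightarrow> 'a \<Rightarrow> 'a) \<Rightarrow> ('a \<Rightarrow> 'a \<Rightarrow> 'a) \<Rightarrow> 'a \<Rightarrow> (jvar \<Rightarrow> 'a) \<Rightarrow> 'k jterm \<Rightarrow> 'a::ab_group_add"
where
  "term_eval sc mul unit \<rho> (Var v) = \<rho> v"
| "term_eval sc mul unit \<rho> Zero = 0"
| "term_eval sc mul unit \<rho> One = unit"
| "term_eval sc mul unit \<rho> (Add s t) =
     term_eval sc mul unit \<rho> s + term_eval sc mul unit \<rho> t"
| "term_eval sc mul unit \<rho> (Scale c s) = sc c (term_eval sc mul unit \<rho> s)"
| "term_eval sc mul unit \<rho> (Mul s t) =
     mul (term_eval sc mul unit \<rho> s) (term_eval sc mul unit \<rho> t)"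

text \<open>Evaluation of a Jordan polynomial under a substitution of the variables. It is computed on
  an arbitrary representing term, which is harmless as soon as the target is a unital Jordan
  algebra (see \<open>eval_abs\<close>).\<close>

definition jordan_eval ::
  "('k::field \<Rightarrow> 'a \<Rightarrow> 'a) \<Rightarrow> ('a \<Rightarrow> 'a \<Rightarrow> 'a) \<Rightarrow> 'a \<Rightarrow> (jvar \<Rightarrow> 'a) \<Rightarrow> 'k free_jordan \<Rightarrow> 'a::ab_group_add"
where
  "jordan_eval sc mul unit \<rho> f = term_eval sc mul unit \<rho> (rep_free_jordan f)"

context unital_jordan_algebra
begin

abbreviation "ev \<equiv> jordan_eval scale mul unit"

lemma term_eval_cong:
  "jeq s t \<Longrightarrow> term_eval scale mul unit \<rho> s = term_eval scale mul unit \<rho> t"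
proof -
  note laws = mul_commute jordan
  show "jeq s t \<Longrightarrow> ?thesis"
  proof (induction rule: jeq.induct)
    case (mul_commute s t)
    show ?case unfolding term_eval.simps by (rule laws)
  next
    case (jordan s t)
    show ?case unfolding term_eval.simps by (rule laws)
  qed (simp_all add: mul_add_left mul_scale_left mul_unit scale_right_distrib scale_left_distrib
       algebra_simps)
qed

lemma eval_abs: "ev \<rho> (abs_free_jordan t) = term_eval scale mul unit \<rho> t"
  unfolding jordan_eval_def
  by (rule term_eval_cong)
     (metis Quotient3_free_jordan Quotient3_def Quotient3_rel_abs Quotient3_abs_rep
        Quotient3_rel_rep Quotient_free_jordan free_jordan.abs_eq_iff)

lemma eval_var: "ev \<rho> (var v) = \<rho> v"
  by (simp add: var.abs_eq eval_abs)

lemma eval_one: "ev \<rho> 1 = unit"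
  by (simp add: one_free_jordan.abs_eq eval_abs)

lemma eval_add: "ev \<rho> (f + g) = ev \<rho> f + ev \<rho> g"
  by (induction f; induction g) (simp add: plus_free_jordan.abs_eq eval_abs)

lemma eval_scale: "ev \<rho> (c *\<^sub>J f) = scale c (ev \<rho> f)"
  by (induction f) (simp add: scaleJ.abs_eq eval_abs)

lemma eval_mult: "ev \<rho> (f * g) = mul (ev \<rho> f) (ev \<rho> g)"
  by (induction f; induction g) (simp add: times_free_jordan.abs_eq eval_abs)

lemma eval_unique:
  assumes lin: "Vector_Spaces.linear scaleJ scale \<phi>" and mult: "\<And>f g. \<phi> (f * g) = mul (\<phi> f) (\<phi> g)"
    and one: "\<phi> 1 = unit" and var: "\<And>v. \<phi> (var v) = \<rho> v"
  shows "\<phi> = ev \<rho>"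
proof
  interpret lin: Vector_Spaces.linear scaleJ scale \<phi> by (fact lin)
  fix f
  have "\<phi> (abs_free_jordan t) = term_eval scale mul unit \<rho> t" for t
  proof (induction t)
    case (Var v)
    then show ?case using var[of v] by (simp add: var.abs_eq)
  next
    case Zero
    then show ?case using lin.zero by (simp add: zero_free_jordan.abs_eq)
  next
    case One
    then show ?case using one by (simp add: one_free_jordan.abs_eq)
  next
    case (Add s t)
    then show ?case by (simp add: lin.add flip: plus_free_jordan.abs_eq)
  next
    case (Scale c s)
    then show ?case by (simp add: lin.scale flip: scaleJ.abs_eq)
  next
    case (Mul s t)
    then show ?case by (simp add: mult flip: times_free_jordan.abs_eq)
  qed
  then show "\<phi> f = ev \<rho> f"
    by (induction f) (simp add: eval_abs)
qed

theorem free_jordan_universal: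
  "\<exists>!\<phi>. Vector_Spaces.linear scaleJ scale \<phi> \<and> (\<forall>f g. \<phi> (f * g) = mul (\<phi> f) (\<phi> g)) \<and>
        \<phi> 1 = unit \<and> (\<forall>v. \<phi> (var v) = \<rho> v)"
proof (rule ex1I[of _ "ev \<rho>"])
  have "Vector_Spaces.linear scaleJ scale (ev \<rho>)"
    by unfold_locales (simp_all add: eval_add eval_scale)
  then show "Vector_Spaces.linear scaleJ scale (ev \<rho>) \<and>
      (\<forall>f g. ev \<rho> (f * g) = mul (ev \<rho> f) (ev \<rho> g)) \<and>
      ev \<rho> 1 = unit \<and> (\<forall>v. ev \<rho> (var v) = \<rho> v)"
    by (simp add: eval_mult eval_one eval_var)
qed (metis eval_unique)

end


subsection \<open>The grading and graded ideals\<close>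

inductive monomial_degree :: "bit \<Rightarrow> 'k::field free_jordan \<Rightarrow> bool" where
  "monomial_degree 0 1"
| "monomial_degree 0 (yv i)"
| "monomial_degree 1 (zv i)"
| "monomial_degree d f \<Longrightarrow> monomial_degree e g \<Longrightarrow> monomial_degree (d + e) (f * g)"

definition J_component :: "bit \<Rightarrow> 'k::field free_jordan set" where
  "J_component d = FJ.span {f. monomial_degree d f}"

definition graded_endomorphism :: "('k::field free_jordan \<Rightarrow> 'k free_jordan) \<Rightarrow> bool" where
  "graded_endomorphism \<phi> \<longleftrightarrow>
     Vector_Spaces.linear scaleJ scaleJ \<phi> \<and> (\<forall>f g. \<phi> (f * g) = \<phi> f * \<phi> g) \<and> \<phi> 1 = 1 \<and>
     (\<forall>d. \<phi> ` J_component d \<subseteq> J_component d)"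

definition T_ideal :: "'k::field free_jordan set \<Rightarrow> bool" where
  "T_ideal I \<longleftrightarrow>
     FJ.subspace I \<and> (\<forall>f\<in>I. \<forall>g. f * g \<in> I \<and> g * f \<in> I) \<and>
     (\<forall>\<phi>. graded_endomorphism \<phi> \<longrightarrow> \<phi> ` I \<subseteq> I)"


section \<open>The algebra \<open>UJ\<^sub>2\<close> with its classical grading\<close>

definition scaleM :: "'k::field \<Rightarrow> 'k^2^2 \<Rightarrow> 'k^2^2" where
  "scaleM c A = map_matrix ((*) c) A"

definition jordan_prod :: "'k::field^2^2 \<Rightarrow> 'k^2^2 \<Rightarrow> 'k^2^2" where
  "jordan_prod A B = scaleM (1/2) (A ** B + B ** A)"

definition matrix_unit :: "2 \<Rightarrow> 2 \<Rightarrow> 'k::field^2^2" where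
  "matrix_unit i j = (\<chi> r s. if r = i \<and> s = j then 1 else 0)"

global_interpretation M2: vector_space "scaleM :: 'k::field \<Rightarrow> _"
  by standard (simp_all add: scaleM_def vec_eq_iff algebra_simps)

definition UT2 :: "('k::field^2^2) set" where
  "UT2 = {A. A $ 2 $ 1 = 0}"

definition UJ2_component :: "bit \<Rightarrow> ('k::field^2^2) set" where
  "UJ2_component d =
     (if d = 0
      then M2.span {matrix_unit 1 1 + matrix_unit 2 2, matrix_unit 1 1 - matrix_unit 2 2}
      else M2.span {matrix_unit 1 2})"

text \<open>In characteristic different from 2 the Jordan product turns all of \<open>M\<^sub>2(K)\<close>, and hence its
  subspace \<open>UT2\<close>, into a unital Jordan algebra, so evaluation below does not depend on
  representatives; and the two components form a grading of \<open>UT2\<close>.\<close>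

lemma unital_jordan_algebra_M2:
  assumes "(2::'k::field) \<noteq> 0"
  shows "unital_jordan_algebra scaleM jordan_prod (mat 1 :: 'k^2^2)"
proof
  fix A B C :: "'k^2^2" and c :: 'k
  note defs = jordan_prod_def scaleM_def vec_eq_iff forall_2 sum_2 matrix_matrix_mult_def mat_def
  show "jordan_prod A B = jordan_prod B A"
    by (simp add: jordan_prod_def add.commute)
  show "jordan_prod (A + B) C = jordan_prod A C + jordan_prod B C"
    by (simp add: defs algebra_simps)
  show "jordan_prod (scaleM c A) B = scaleM c (jordan_prod A B)"
    by (simp add: defs algebra_simps)
  have "(1/2 + 1/2 :: 'k) = 1"
    using assms by simp
  then have half: "scaleM (1/2) (X + X) = X" for X :: "'k^2^2"
    by (metis M2.scale_left_distrib M2.scale_one M2.scale_right_distrib)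
  show "jordan_prod (mat 1) A = A"
    unfolding jordan_prod_def matrix_mul_lid matrix_mul_rid by (rule half)
  show "jordan_prod (jordan_prod (jordan_prod A A) B) A =
        jordan_prod (jordan_prod A A) (jordan_prod B A)"
  proof -
    have scale_l: "scaleM c A ** B = scaleM c (A ** B)" and
      scale_r: "A ** scaleM c B = scaleM c (A ** B)" for c :: 'k and A B :: "'k^2^2"
      by (simp_all add: defs algebra_simps)
    have mult_add_r: "(A + B) ** C = A ** C + B ** C" for A B C :: "'k^2^2"
      by (simp add: defs algebra_simps)
    have square: "jordan_prod A A = A ** A"
      unfolding jordan_prod_def by (rule half)
    show ?thesis
      unfolding square
      by (simp add: jordan_prod_def scale_l scale_r M2.scale_right_distrib
            matrix_add_ldistrib mult_add_r matrix_mul_assoc add_ac)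
  qed
qed

lemma UJ2_component_0:
  assumes "(2::'k::field) \<noteq> 0"
  shows "UJ2_component 0 = {A :: 'k^2^2. A $ 1 $ 2 = 0 \<and> A $ 2 $ 1 = 0}"
proof -
  let ?P = "matrix_unit 1 1 + matrix_unit 2 2 :: 'k^2^2"
  let ?M = "matrix_unit 1 1 - matrix_unit 2 2 :: 'k^2^2"
  have half: "x / 2 + x / 2 = x" for x :: 'k
    using assms by (metis add_divide_distrib mult_2 nonzero_mult_div_cancel_left)
  have "A \<in> M2.span {?P, ?M}" if "A $ 1 $ 2 = 0" "A $ 2 $ 1 = 0" for A :: "'k^2^2"
  proof -
    have "A = scaleM ((A$1$1 + A$2$2)/2) ?P + scaleM ((A$1$1 - A$2$2)/2) ?M"
      using that assms
      by (simp add: vec_eq_iff forall_2 scaleM_def matrix_unit_def add_divide_distrib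
            diff_divide_distrib half)
    also have "\<dots> \<in> M2.span {?P, ?M}"
      by (intro M2.span_add M2.span_scale M2.span_base) auto
    finally show ?thesis .
  qed
  moreover have "M2.span {?P, ?M} \<subseteq> {A. A $ 1 $ 2 = 0 \<and> A $ 2 $ 1 = 0}"
    by (rule M2.span_minimal)
       (auto simp: matrix_unit_def M2.subspace_def scaleM_def)
  ultimately show ?thesis
    unfolding UJ2_component_def by auto
qed

lemma UJ2_component_1:
  "UJ2_component 1 = {A :: 'k::field^2^2. A $ 1 $ 1 = 0 \<and> A $ 2 $ 1 = 0 \<and> A $ 2 $ 2 = 0}"
proof -
  have "A \<in> M2.span {matrix_unit 1 2}" if "A $ 1 $ 1 = 0 \<and> A $ 2 $ 1 = 0 \<and> A $ 2 $ 2 = 0"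
    for A :: "'k^2^2"
  proof -
    have "A = scaleM (A$1$2) (matrix_unit 1 2)"
      using that by (simp add: vec_eq_iff forall_2 scaleM_def matrix_unit_def)
    also have "\<dots> \<in> M2.span {matrix_unit 1 2}"
      by (intro M2.span_scale M2.span_base) auto
    finally show ?thesis .
  qed
  moreover have "M2.span {matrix_unit 1 2 :: 'k^2^2} \<subseteq>
      {A. A $ 1 $ 1 = 0 \<and> A $ 2 $ 1 = 0 \<and> A $ 2 $ 2 = 0}"
    by (rule M2.span_minimal)
       (auto simp: matrix_unit_def M2.subspace_def scaleM_def)
  ultimately show ?thesis
    unfolding UJ2_component_def by auto
qed

lemma UT2_direct_sum:
  assumes "(2::'k::field) \<noteq> 0"
  shows "UT2 = {B + C :: 'k^2^2 | B C. B \<in> UJ2_component 0 \<and> C \<in> UJ2_component 1}"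
    and "UJ2_component 0 \<inter> UJ2_component 1 = {0 :: 'k^2^2}"
proof -
  have "\<exists>B C. A = B + C \<and> B \<in> UJ2_component 0 \<and> C \<in> UJ2_component 1"
    if "A \<in> UT2" for A :: "'k^2^2"
  proof (intro exI conjI)
    let ?C = "scaleM (A $ 1 $ 2) (matrix_unit 1 2)"
    show "A = (A - ?C) + ?C" by simp
    show "A - ?C \<in> UJ2_component 0" "?C \<in> UJ2_component 1"
      using that assms
      by (simp_all add: UJ2_component_0 UJ2_component_1 UT2_def scaleM_def matrix_unit_def)
  qed
  then show "UT2 = {B + C :: 'k^2^2 | B C. B \<in> UJ2_component 0 \<and> C \<in> UJ2_component 1}"
    using assms by (auto simp: UJ2_component_0 UJ2_component_1 UT2_def)
  show "UJ2_component 0 \<inter> UJ2_component 1 = {0 :: 'k^2^2}"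
    using assms by (auto simp: UJ2_component_0 UJ2_component_1 vec_eq_iff forall_2)
qed

lemma UJ2_component_mult:
  assumes "(2::'k::field) \<noteq> 0" and "B \<in> UJ2_component d" and "C \<in> UJ2_component e"
  shows "jordan_prod B (C::'k^2^2) \<in> UJ2_component (d + e)"
  using assms
  by (cases d; cases e)
     (auto simp: UJ2_component_0 UJ2_component_1 jordan_prod_def scaleM_def
       matrix_matrix_mult_def sum_2)


section \<open>Graded identities of \<open>UJ\<^sub>2\<close>\<close>

definition T_Cla :: "'k::field free_jordan set" where
  "T_Cla = {f. \<forall>\<rho>. (\<forall>i. \<rho> (Y i) \<in> UJ2_component 0) \<and> (\<forall>i. \<rho> (Z i) \<in> UJ2_component 1) \<longrightarrow>
                 jordan_eval scaleM jordan_prod (mat 1) \<rho> f = 0}"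

definition associator :: "'a::{minus,times} \<Rightarrow> 'a \<Rightarrow> 'a \<Rightarrow> 'a" where
  "associator u v w = (u * v) * w - u * (v * w)"

definition I_Cla :: "'k::field free_jordan set" where
  "I_Cla = T_ideal hull {associator (yv 0) (yv 1) (yv 2), zv 0 * zv 1, associator (yv 0) (zv 0) (yv 1)}"

text \<open>Left-normed monomial \<open>y\<^bsub>i\<^sub>1\<^esub> \<cdots> y\<^bsub>i\<^sub>r\<^esub>\<close> with list of indices \<open>ms\<close>.\<close>

definition ymon :: "nat list \<Rightarrow> 'k::field free_jordan" where
  "ymon ms = foldl (*) 1 (map yv ms)"

definition index_le :: "nat list \<Rightarrow> nat list \<Rightarrow> bool" where
  "index_le ms ns \<longleftrightarrow> (ms, ns) \<in> lenlex less_than \<or> ms = ns"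

definition S_Cla :: "'k::field free_jordan set" where
  "S_Cla = {ymon ms | ms. sorted ms} \<union>
           {ymon ms * (zv i * ymon ns) | i ms ns. sorted ms \<and> sorted ns \<and> index_le ms ns}"


section \<open>The quotient space \<open>J(X)/I\<close>\<close>

lemma subspace_I_Cla: "FJ.subspace I_Cla"
  unfolding I_Cla_def hull_def by (rule FJ.subspace_Inter) (auto simp: T_ideal_def)

quotient_type (overloaded) 'k J_mod_I = "'k::field free_jordan" / "\<lambda>f g. f - g \<in> I_Cla"
proof (rule equivpI)
  show "reflp (\<lambda>f g. f - g \<in> (I_Cla :: 'k free_jordan set))"
    by (rule reflpI) (simp add: FJ.subspace_0[OF subspace_I_Cla])
  show "symp (\<lambda>f g. f - g \<in> (I_Cla :: 'k free_jordan set))"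
    by (rule sympI) (metis FJ.subspace_neg[OF subspace_I_Cla] minus_diff_eq)
  show "transp (\<lambda>f g. f - g \<in> (I_Cla :: 'k free_jordan set))"
  proof (rule transpI)
    fix f g h :: "'k free_jordan"
    assume "f - g \<in> I_Cla" "g - h \<in> I_Cla"
    then show "f - h \<in> I_Cla"
      using FJ.subspace_add[OF subspace_I_Cla, of "f - g" "g - h"] by simp
  qed
qed

instantiation J_mod_I :: (field) ab_group_add
begin

lift_definition zero_J_mod_I :: "'a J_mod_I" is 0 .
lift_definition plus_J_mod_I :: "'a J_mod_I \<Rightarrow> 'a J_mod_I \<Rightarrow> 'a J_mod_I" is "(+)"
  by (metis FJ.subspace_add[OF subspace_I_Cla] add_diff_add)
lift_definition uminus_J_mod_I :: "'a J_mod_I \<Rightarrow> 'a J_mod_I" is uminus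
  by (metis FJ.subspace_neg[OF subspace_I_Cla] minus_diff_minus)
lift_definition minus_J_mod_I :: "'a J_mod_I \<Rightarrow> 'a J_mod_I \<Rightarrow> 'a J_mod_I" is "(-)"
  by (metis FJ.subspace_diff[OF subspace_I_Cla] diff_diff_eq2 add_diff_add diff_diff_add diff_add_eq add.commute)

instance
  by standard (transfer; simp add: FJ.subspace_0[OF subspace_I_Cla] algebra_simps)+

end

lift_definition scaleQ :: "'k::field \<Rightarrow> 'k J_mod_I \<Rightarrow> 'k J_mod_I" is scaleJ
  by (metis FJ.subspace_scale[OF subspace_I_Cla] FJ.scale_right_diff_distrib)

definition coset :: "'k::field free_jordan \<Rightarrow> 'k J_mod_I" where
  "coset = abs_J_mod_I"

global_interpretation Q: vector_space "scaleQ :: 'k::field \<Rightarrow> _"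
  by standard
     (transfer; simp add: FJ.subspace_0[OF subspace_I_Cla] FJ.scale_right_distrib FJ.scale_left_distrib)+

lemma coset_eq_iff: "coset f = coset g \<longleftrightarrow> f - g \<in> I_Cla"
  by (simp add: coset_def J_mod_I.abs_eq_iff)

lemma coset_add: "coset (f + g) = coset f + coset g"
  by (simp add: coset_def plus_J_mod_I.abs_eq)

lemma coset_scale: "coset (c *\<^sub>J f) = scaleQ c (coset f)"
  by (simp add: coset_def scaleQ.abs_eq)

end

theory Submission
  imports Defs
begin

text \<open>Modulo \<open>I\<close> the even part is commutative and associative, products of odd elements vanish,
  and multiplications by even elements commute on the odd part. The linearised Jordan identity then
  reads \<open>2 L\<^sub>a L\<^sub>b L\<^sub>c = L\<^bsub>ab\<^esub> L\<^sub>c + L\<^bsub>ac\<^esub> L\<^sub>b + L\<^bsub>bc\<^esub> L\<^sub>a - L\<^bsub>abc\<^esub>\<close> for these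
  multiplications, so two factors suffice and \<open>S\<close> spans \<open>J(X)/I\<close>. Conversely, substituting
  \<open>diag(a\<^sub>i, b\<^sub>i)\<close> for \<open>y\<^sub>i\<close> and \<open>e\<^bsub>12\<^esub>\<close> for \<open>z\<^sub>i\<close> turns \<open>Y'(z\<^sub>i Y'')\<close> into
  \<open>(Y'(a) + Y'(b)) (Y''(a) + Y''(b)) / 4\<close> times \<open>e\<^bsub>12\<^esub>\<close>. Monomial functions over an infinite field
  are distinct characters of a monoid, hence linearly independent, so no nontrivial combination of
  \<open>S\<close> is an identity.\<close>

section \<open>Linear independence of monomial functions\<close>

text \<open>Artin's argument: evaluate the relation at \<open>m x y\<close> and subtract
  \<open>\<psi> q x\<close> times the relation at \<open>y\<close>. The term of \<open>q\<close>
  cancels, leaving a relation on \<open>G\<close> with coefficients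
  \<open>D p * (\<psi> p x - \<psi> q x)\<close>.\<close>

lemma characters_independent:
  fixes \<psi> :: "'i \<Rightarrow> 'x \<Rightarrow> 'k::field" and m :: "'x \<Rightarrow> 'x \<Rightarrow> 'x"
  assumes "finite G"
    and "\<And>p x y. \<psi> p (m x y) = \<psi> p x * \<psi> p y" and "\<And>p. \<psi> p e = 1"
    and "\<And>p q. p \<in> G \<Longrightarrow> q \<in> G \<Longrightarrow> p \<noteq> q \<Longrightarrow> \<exists>x. \<psi> p x \<noteq> \<psi> q x"
    and "\<And>x. (\<Sum>p\<in>G. D p * \<psi> p x) = 0"
  shows "\<forall>p\<in>G. D p = 0"
  using assms(1,4,5)
proof (induction G arbitrary: D rule: finite_induct)
  case empty
  then show ?case by simp
next
  case (insert q G)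
  have eq: "D q * \<psi> q x + (\<Sum>p\<in>G. D p * \<psi> p x) = 0" for x
    using insert.prems(2)[of x] insert.hyps by simp
  have "D p = 0" if "p \<in> G" for p
  proof -
    obtain x where x: "\<psi> p x \<noteq> \<psi> q x"
      using insert.prems(1)[of p q] \<open>p \<in> G\<close> insert.hyps(2) by blast
    have "(\<Sum>p\<in>G. D p * (\<psi> p x - \<psi> q x) * \<psi> p y) = 0" for y
    proof -
      have "(\<Sum>p\<in>G. D p * (\<psi> p x - \<psi> q x) * \<psi> p y) =
          (\<Sum>p\<in>G. D p * \<psi> p (m x y)) - \<psi> q x * (\<Sum>p\<in>G. D p * \<psi> p y)"
        by (simp add: assms(2) sum_distrib_left sum_subtractf[symmetric] algebra_simps)
      also have "\<dots> = - D q * \<psi> q (m x y) - \<psi> q x * (- D q * \<psi> q y)"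
        using eq[of "m x y"] eq[of y] by (simp add: add_eq_0_iff2)
      also have "\<dots> = 0"
        by (simp add: assms(2))
      finally show ?thesis .
    qed
    then have "\<forall>p\<in>G. D p * (\<psi> p x - \<psi> q x) = 0"
      using insert.prems(1) by (intro insert.IH) auto
    with x \<open>p \<in> G\<close> show ?thesis by auto
  qed
  \<comment> \<open>At \<open>e\<close> every character takes the value 1, so only
    \<open>D q\<close> is left of the relation.\<close>
  moreover from this have "D q = 0"
    using eq[of e] by (simp add: assms(3))
  ultimately show ?case by simp
qed

section \<open>Monomial functions over an infinite field\<close>

abbreviation mon_fun :: "(nat \<Rightarrow> 'k::comm_monoid_mult) \<Rightarrow> nat list \<Rightarrow> 'k" where
  "mon_fun a ms \<equiv> prod_list (map a ms)"

lemma mon_fun_mult: "mon_fun (\<lambda>i. a i * b i) ms = mon_fun a ms * mon_fun b ms"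
  by (induction ms) (simp_all add: ac_simps)

lemma mon_fun_one: "mon_fun (\<lambda>i. 1) ms = 1"
  by (induction ms) simp_all

lemma mon_fun_sort: "mon_fun a (sort ms) = mon_fun a ms"
  by (simp flip: prod_mset_prod_list)

text \<open>Setting all variables but one to 1 exposes the exponent of that variable, by which
  monomials are told apart below.\<close>

lemma mon_fun_delta: "mon_fun (\<lambda>j. if j = i then x else 1) ms = x ^ count_list ms i"
  by (induction ms) auto

text \<open>A nonzero polynomial has finitely many roots. This is where the infinity of the field
  enters.\<close>

lemma exists_power_neq:
  assumes "infinite (UNIV :: 'k::field set)" "m \<noteq> n"
  shows "\<exists>x::'k. x ^ m \<noteq> x ^ n"
proof (rule ccontr)
  assume "\<not> ?thesis"
  then have "{x::'k. poly (monom 1 m - monom 1 n) x = 0} = UNIV"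
    by (simp add: poly_monom)
  then have "monom (1::'k) m - monom 1 n = 0"
    using poly_roots_finite[of "monom (1::'k) m - monom 1 n"] assms(1) by auto
  then show False
    using assms(2) by (simp add: monom_eq_iff')
qed

text \<open>Distinct sorted lists have distinct multisets, so some variable occurs with different
  exponents.\<close>

lemma mon_fun_distinct:
  assumes "infinite (UNIV :: 'k::field set)" "sorted ms" "sorted ns" "ms \<noteq> ns"
  shows "\<exists>a. mon_fun a ms \<noteq> (mon_fun a ns :: 'k)"
proof -
  have "mset ms \<noteq> mset ns"
    using assms(2-4) properties_for_sort[of ms ns] by (auto simp: sorted_sort_id)
  then obtain i where "count_list ms i \<noteq> count_list ns i"
    by (auto simp: multiset_eq_iff count_mset)
  then obtain x :: 'k where "x ^ count_list ms i \<noteq> x ^ count_list ns i"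
    using exists_power_neq[OF assms(1)] by blast
  then show ?thesis
    by (intro exI[of _ "\<lambda>j. if j = i then x else 1"]) (simp add: mon_fun_delta)
qed

text \<open>Each pair of lists is a character of the monoid of pairs of points \<open>(a, b)\<close>
  under pointwise multiplication.\<close>

lemma mon_fun_independent:
  fixes D :: "nat list \<times> nat list \<Rightarrow> 'k::field"
  assumes inf: "infinite (UNIV :: 'k set)" and "finite G"
    and sorted: "\<And>p q. (p, q) \<in> G \<Longrightarrow> sorted p \<and> sorted q"
    and zero: "\<And>a b. (\<Sum>(p, q)\<in>G. D (p, q) * (mon_fun a p * mon_fun b q)) = 0"
  shows "\<forall>p\<in>G. D p = 0"
proof (rule characters_independent)
  define m :: "(nat \<Rightarrow> 'k) \<times> (nat \<Rightarrow> 'k) \<Rightarrow> (nat \<Rightarrow> 'k) \<times> (nat \<Rightarrow> 'k) \<Rightarrow> _"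
    where "m x y = ((\<lambda>i. fst x i * fst y i), (\<lambda>i. snd x i * snd y i))" for x y
  define \<psi> :: "nat list \<times> nat list \<Rightarrow> (nat \<Rightarrow> 'k) \<times> (nat \<Rightarrow> 'k) \<Rightarrow> 'k"
    where "\<psi> p x = mon_fun (fst x) (fst p) * mon_fun (snd x) (snd p)" for p x
  have sorted_parts: "sorted (fst p) \<and> sorted (snd p)" if "p \<in> G" for p
    using sorted[of "fst p" "snd p"] that by simp
  show "finite G" by fact
  show "\<psi> p (m x y) = \<psi> p x * \<psi> p y" for p x y
    by (simp add: \<psi>_def m_def mon_fun_mult)
  show "\<psi> p (\<lambda>i. 1, \<lambda>i. 1) = 1" for p
    by (simp add: \<psi>_def mon_fun_one)
  show "(\<Sum>p\<in>G. D p * \<psi> p x) = 0" for x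
    using zero[of "fst x" "snd x"] by (simp add: \<psi>_def case_prod_beta)
  show "\<exists>x. \<psi> p x \<noteq> \<psi> q x" if pq: "p \<in> G" "q \<in> G" "p \<noteq> q" for p q
  \<comment> \<open>One point is kept at the constant 1; the other varies in the component where the
    pairs differ.\<close>
  proof (cases "fst p = fst q")
    case True
    with that have "snd p \<noteq> snd q" by (simp add: prod_eq_iff)
    then obtain b where "mon_fun b (snd p) \<noteq> (mon_fun b (snd q) :: 'k)"
      using mon_fun_distinct[OF inf, of "snd p" "snd q"] sorted_parts pq by blast
    then have "\<psi> p (\<lambda>i. 1, b) \<noteq> \<psi> q (\<lambda>i. 1, b)"
      by (simp add: \<psi>_def mon_fun_one)
    then show ?thesis by blast
  next
    case False
    then obtain a where "mon_fun a (fst p) \<noteq> (mon_fun a (fst q) :: 'k)"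
      using mon_fun_distinct[OF inf, of "fst p" "fst q"] sorted_parts pq by blast
    then have "\<psi> p (a, \<lambda>i. 1) \<noteq> \<psi> q (a, \<lambda>i. 1)"
      by (simp add: \<psi>_def mon_fun_one)
    then show ?thesis by blast
  qed
qed

section \<open>The order on index lists and the symmetric products\<close>

lemma index_le_length: "index_le ms ns \<Longrightarrow> length ms \<le> length ns"
  by (auto simp: index_le_def lenlex_conv)

lemma index_le_antisym: "index_le ms ns \<Longrightarrow> index_le ns ms \<Longrightarrow> ms = ns"
  unfolding index_le_def
  by (metis asym_less_than asym_lenlex asymD)

lemma index_le_total: "index_le ms ns \<or> index_le ns ms"
  unfolding index_le_def
  by (metis UNIV_I total_lenlex total_less_than total_on_def)

lemma four_neq_zero:
  assumes "(2::'k::field) \<noteq> 0"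
  shows "(4::'k) \<noteq> 0"
proof -
  have "(4::'k) = 2 * 2" by simp
  then show ?thesis using assms by (simp only: mult_eq_0_iff) simp
qed

text \<open>For nonempty \<open>ms\<close> the monomial function of \<open>(ms, ns)\<close> occurs in the expansion of the
  product belonging to \<open>(ms, ns)\<close> only, which kills these coefficients first.\<close>

lemma symmetric_products_independent:
  fixes d :: "nat list \<times> nat list \<Rightarrow> 'k::field"
  assumes inf: "infinite (UNIV :: 'k set)" and two: "(2::'k) \<noteq> 0" and fin: "finite G"
    and G: "\<And>m n. (m, n) \<in> G \<Longrightarrow> sorted m \<and> sorted n \<and> index_le m n"
    and zero: "\<And>a b. (\<Sum>(m, n)\<in>G. d (m, n) *
      ((mon_fun a m + mon_fun b m) * (mon_fun a n + mon_fun b n))) = 0"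
  shows "\<forall>t\<in>G. d t = 0"
proof -
  \<comment> \<open>Expanding the product of \<open>t = (m, n)\<close> gives four monomials: the one
    of \<open>m @ n\<close> in \<open>a\<close> alone (\<open>T1\<close>), the same in
    \<open>b\<close> alone (\<open>T2\<close>), the mixed one of \<open>t\<close> itself, and the
    mixed one with the points exchanged (\<open>T4\<close>). They may coincide, so
    \<open>k t q\<close> counts multiplicities; \<open>D q\<close> is the total coefficient of
    \<open>q\<close>.\<close>
  define T1 T2 T4 :: "nat list \<times> nat list \<Rightarrow> nat list \<times> nat list"
    where T_def: "T1 t = (sort (fst t @ snd t), [])" "T2 t = ([], sort (fst t @ snd t))"
      "T4 t = (snd t, fst t)" for t
  define k :: "nat list \<times> nat list \<Rightarrow> nat list \<times> nat list \<Rightarrow> 'k" where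
    "k t q = of_bool (T1 t = q) + of_bool (T2 t = q) + of_bool (t = q) + of_bool (T4 t = q)" for t q
  define D where "D q = (\<Sum>t\<in>G. d t * k t q)" for q
  define H where "H = T1 ` G \<union> T2 ` G \<union> G \<union> T4 ` G"
  have "finite H" using fin by (simp add: H_def)
  have "\<forall>q\<in>H. D q = 0"
  proof (rule mon_fun_independent[OF inf \<open>finite H\<close>])
    show "sorted p \<and> sorted q" if "(p, q) \<in> H" for p q
      using that G by (auto simp: H_def T_def)
    fix a b :: "nat \<Rightarrow> 'k"
    let ?c = "\<lambda>q. mon_fun a (fst q) * mon_fun b (snd q)"
    have "(\<Sum>q\<in>H. D q * ?c q) = (\<Sum>q\<in>H. \<Sum>t\<in>G. d t * (k t q * ?c q))"
      by (simp add: D_def sum_distrib_right mult.assoc)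
    also have "\<dots> = (\<Sum>t\<in>G. d t * (\<Sum>q\<in>H. k t q * ?c q))"
      by (subst sum.swap) (simp add: sum_distrib_left)
    also have "\<dots> = (\<Sum>t\<in>G. d t *
        ((mon_fun a (fst t) + mon_fun b (fst t)) * (mon_fun a (snd t) + mon_fun b (snd t))))"
    proof (rule sum.cong[OF HOL.refl])
      fix t assume "t \<in> G"
      have delta: "(\<Sum>q\<in>H. of_bool (s = q) * ?c q) = ?c s" if "s \<in> H" for s
      proof -
        have "(\<Sum>q\<in>H. of_bool (s = q) * ?c q) = (\<Sum>q\<in>H. if s = q then ?c q else 0)"
          by (intro sum.cong) auto
        then show ?thesis using that \<open>finite H\<close> by simp
      qed
      have "(\<Sum>q\<in>H. k t q * ?c q) = ?c (T1 t) + ?c (T2 t) + ?c t + ?c (T4 t)"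
        using \<open>t \<in> G\<close>
        by (simp add: k_def distrib_right sum.distrib delta) (simp add: H_def delta[unfolded H_def])
      then show "d t * (\<Sum>q\<in>H. k t q * ?c q) = d t *
        ((mon_fun a (fst t) + mon_fun b (fst t)) * (mon_fun a (snd t) + mon_fun b (snd t)))"
        by (simp add: T_def mon_fun_sort algebra_simps)
    qed
    also have "\<dots> = 0"
      using zero[of a b] by (simp add: case_prod_beta)
    finally show "(\<Sum>(p, q)\<in>H. D (p, q) * (mon_fun a p * mon_fun b q)) = 0"
      by (simp add: case_prod_beta)
  qed
  then have D0: "D t = 0" if "t \<in> G" for t
    using that by (simp add: H_def)
  \<comment> \<open>If no other pair contributes to the coefficient of \<open>t\<close>, then
    \<open>D t\<close> is just \<open>d t * k t t\<close>.\<close>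
  have single: "d t = 0" if t: "t \<in> G" and "k t t \<noteq> 0"
    and other: "\<And>s. s \<in> G \<Longrightarrow> s \<noteq> t \<Longrightarrow> d s * k s t = 0" for t
  proof -
    have "(\<Sum>s\<in>G - {t}. d s * k s t) = 0"
      using other by (intro sum.neutral) blast
    then have "D t = d t * k t t"
      unfolding D_def using sum.remove[OF fin t, of "\<lambda>s. d s * k s t"] by simp
    then show ?thesis using D0[OF t] \<open>k t t \<noteq> 0\<close> by simp
  qed
  have sort_Nil: "sort l = [] \<longleftrightarrow> l = []" for l :: "nat list"
    by (metis length_0_conv length_sort)
  \<comment> \<open>Here \<open>n\<close> is nonempty too, by length, so \<open>T1\<close> and
    \<open>T2\<close>, having an empty component, never hit \<open>(m, n)\<close>. If
    \<open>T4 s = (m, n)\<close>, then \<open>s = (n, m)\<close> and antisymmetry of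
    \<open>index_le\<close> gives \<open>s = (m, n)\<close>. The multiplicity is 1, or 2 if
    \<open>m = n\<close>.\<close>
  have step1: "d (m, n) = 0" if "(m, n) \<in> G" "m \<noteq> []" for m n
  proof (rule single)
    have "n \<noteq> []"
      using G[OF that(1)] index_le_length that(2) by fastforce
    with that two show "k (m, n) (m, n) \<noteq> 0"
      by (auto simp: k_def T_def)
    fix s assume "s \<in> G" "s \<noteq> (m, n)"
    moreover have "T4 s \<noteq> (m, n)"
      using G \<open>s \<in> G\<close> \<open>s \<noteq> (m, n)\<close> that(1) index_le_antisym
      by (cases s) (auto simp: T_def)
    ultimately show "d s * k s (m, n) = 0"
      using \<open>m \<noteq> []\<close> \<open>n \<noteq> []\<close> by (auto simp: k_def T_def)
  qed fact
  \<comment> \<open>Now \<open>T2\<close> hits \<open>([], n)\<close> as well, so the multiplicity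
    is 2, or 4 if \<open>n = []\<close>. Other pairs with empty first list yield different
    monomials; those with nonempty first list have coefficient 0 by \<open>step1\<close>.\<close>
  have step2: "d ([], n) = 0" if "([], n) \<in> G" for n
  proof (rule single)
    have "sort n = n"
      using G[OF that] by (simp add: sorted_sort_id)
    then show "k ([], n) ([], n) \<noteq> 0"
      using two four_neq_zero[OF two] by (auto simp: k_def T_def sort_Nil)
    fix s assume s: "s \<in> G" "s \<noteq> ([], n)"
    show "d s * k s ([], n) = 0"
    proof (cases "fst s = []")
      case True
      then obtain n' where n': "s = ([], n')" by (metis prod.collapse)
      with s G have "sort n' = n'" by (auto simp: sorted_sort_id)
      with n' s show ?thesis by (auto simp: k_def T_def)
    next
      case False
      with step1 s show ?thesis by (metis mult_zero_left prod.collapse)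
    qed
  qed fact
  show ?thesis
  proof
    fix t assume "t \<in> G"
    then show "d t = 0"
      using step1[of "fst t" "snd t"] step2[of "snd t"] by (cases t) auto
  qed
qed

section \<open>Graded identities form a T-ideal\<close>

lemma (in unital_jordan_algebra) mul_add_right: "mul z (x + y) = mul z x + mul z y"
  using mul_add_left[of x y z] by (simp add: mul_commute[of z])

lemma (in unital_jordan_algebra) mul_scale_right: "mul y (scale c x) = scale c (mul y x)"
  using mul_scale_left[of c x y] by (simp add: mul_commute[of y])

lemma (in unital_jordan_algebra) mul_zero_left: "mul 0 x = 0"
  using mul_add_left[of 0 0 x] by simp

lemma (in unital_jordan_algebra) mul_zero_right: "mul x 0 = 0"
  using mul_zero_left[of x] by (simp add: mul_commute[of x])

lemma (in unital_jordan_algebra) mul_uminus_left: "mul (- x) y = - mul x y"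
  using mul_add_left[of "- x" x y] by (simp add: mul_zero_left eq_neg_iff_add_eq_0)

lemma (in unital_jordan_algebra) mul_uminus_right: "mul y (- x) = - mul y x"
  using mul_uminus_left[of x y] by (simp add: mul_commute[of y])

lemma (in unital_jordan_algebra) mul_diff_left: "mul (x - y) z = mul x z - mul y z"
  using mul_add_left[of x "- y" z] by (simp add: mul_uminus_left)

lemma (in unital_jordan_algebra) mul_diff_right: "mul z (x - y) = mul z x - mul z y"
  using mul_diff_left[of x y z] by (simp add: mul_commute[of z])

lemmas (in unital_jordan_algebra) mul_distribs =
  mul_add_left mul_add_right mul_scale_left mul_scale_right mul_zero_left mul_zero_right
  mul_uminus_left mul_uminus_right mul_diff_left mul_diff_right

text \<open>Bilinearity reduces the claim to generators. It serves both for the grading of the free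
  algebra and for the span of \<open>S_Cla\<close>.\<close>

lemma (in unital_jordan_algebra) mul_span:
  assumes gen: "\<And>x y. x \<in> A \<Longrightarrow> y \<in> B \<Longrightarrow> mul x y \<in> V" and V: "subspace V"
    and x: "x \<in> span A" and y: "y \<in> span B"
  shows "mul x y \<in> V"
  using x
proof (induction rule: span_induct_alt)
  case base
  then show ?case using V by (simp add: mul_zero_left subspace_0)
next
  case (step c a x)
  have "mul a y \<in> V"
    using y
  proof (induction rule: span_induct_alt)
    case base
    then show ?case using V by (simp add: mul_zero_right subspace_0)
  next
    case (step d b y)
    then show ?case
      using V gen \<open>a \<in> A\<close> by (simp add: mul_distribs subspace_add subspace_scale)
  qed
  then show ?case
    using V step by (simp add: mul_distribs subspace_add subspace_scale)
qed

text \<open>The family \<open>C\<close> is left arbitrary so that the lemma covers graded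
  endomorphisms of the free algebra as well as graded substitutions into matrices.\<close>

lemma (in unital_jordan_algebra) ev_component:
  fixes C :: "bit \<Rightarrow> 'a set"
  assumes sub: "\<And>d. subspace (C d)"
    and mult: "\<And>d e x y. x \<in> C d \<Longrightarrow> y \<in> C e \<Longrightarrow> mul x y \<in> C (d + e)"
    and unit: "unit \<in> C 0" and Y: "\<And>i. \<rho> (Y i) \<in> C 0" and Z: "\<And>i. \<rho> (Z i) \<in> C 1"
    and f: "f \<in> J_component d"
  shows "ev \<rho> f \<in> C d"
proof -
  have mono: "ev \<rho> f \<in> C d" if "monomial_degree d f" for f d
    using that
    by induction (simp_all only: eval_one eval_var eval_mult unit Y Z mult)
  have zero: "ev \<rho> 0 = 0"
    using eval_add[of \<rho> 0 0] by simp
  show ?thesis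
    using f[unfolded J_component_def]
  proof (induction rule: FJ.span_induct_alt)
    case base
    then show ?case using sub zero by (simp add: subspace_0)
  next
    case (step c x y)
    then show ?case
      using sub mono by (simp add: eval_add eval_scale subspace_add subspace_scale)
  qed
qed

lemma J_component_subspace: "FJ.subspace (J_component d)"
  by (simp add: J_component_def)

lemma J_component_mult:
  assumes "f \<in> J_component d" "g \<in> J_component e"
  shows "f * g \<in> J_component (d + e)"
  by (rule FJ.mul_span[OF _ J_component_subspace assms[unfolded J_component_def]])
     (simp only: J_component_def mem_Collect_eq FJ.span_base monomial_degree.intros)

lemma J_component_one: "1 \<in> J_component 0"
  and J_component_yv: "yv i \<in> J_component 0"
  and J_component_zv: "zv i \<in> J_component 1"
  by (auto simp: J_component_def intro: FJ.span_base monomial_degree.intros)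

lemma graded_endomorphism_eval:
  assumes "\<And>i. \<rho> (Y i) \<in> J_component 0" "\<And>i. \<rho> (Z i) \<in> J_component 1"
  shows "graded_endomorphism (FJ.ev \<rho>)"
  unfolding graded_endomorphism_def
proof (intro conjI allI image_subsetI)
  show "Vector_Spaces.linear scaleJ scaleJ (FJ.ev \<rho>)"
    by unfold_locales (simp_all add: FJ.eval_add FJ.eval_scale)
  show "FJ.ev \<rho> f \<in> J_component d" if "f \<in> J_component d" for f d
    by (rule FJ.ev_component[OF J_component_subspace J_component_mult J_component_one assms that])
qed (simp_all add: FJ.eval_mult FJ.eval_one)

lemma UJ2_component_subspace: "M2.subspace (UJ2_component d)"
  by (simp add: UJ2_component_def)

lemma UJ2_component_one:
  assumes "(2::'k::field) \<noteq> 0"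
  shows "(mat 1 :: 'k^2^2) \<in> UJ2_component 0"
  by (simp add: UJ2_component_0[OF assms] mat_def)

text \<open>The essential point is stability: a graded endomorphism followed by a graded
  substitution is again a graded substitution.\<close>

lemma T_ideal_T_Cla:
  assumes two: "(2::'k::field) \<noteq> 0"
  shows "T_ideal (T_Cla :: 'k free_jordan set)"
proof -
  interpret M: unital_jordan_algebra scaleM jordan_prod "mat 1 :: 'k^2^2"
    by (rule unital_jordan_algebra_M2[OF two])
  have zero: "M.ev \<rho> 0 = 0" for \<rho>
    using M.eval_add[of \<rho> 0 0] by simp
  show ?thesis
    unfolding T_ideal_def
  proof (intro conjI allI ballI impI)
    show "FJ.subspace (T_Cla :: 'k free_jordan set)"
      by (auto simp: FJ.subspace_def T_Cla_def zero M.eval_add M.eval_scale)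
    fix \<phi> :: "'k free_jordan \<Rightarrow> 'k free_jordan"
    assume \<phi>: "graded_endomorphism \<phi>"
    then interpret lin: Vector_Spaces.linear scaleJ scaleJ \<phi>
      by (simp add: graded_endomorphism_def)
    have \<phi>_component: "\<phi> g \<in> J_component d" if "g \<in> J_component d" for g d
    proof -
      have "\<phi> ` J_component d \<subseteq> J_component d"
        using \<phi> unfolding graded_endomorphism_def by (elim conjE) (rule spec)
      with that show ?thesis by (simp add: image_subset_iff)
    qed
    show "\<phi> ` T_Cla \<subseteq> T_Cla"
    proof (intro image_subsetI)
      fix f :: "'k free_jordan"
      assume f: "f \<in> T_Cla"
      have "M.ev \<rho> (\<phi> f) = 0"
        if \<rho>: "\<forall>i. \<rho> (Y i) \<in> UJ2_component 0" "\<forall>i. \<rho> (Z i) \<in> UJ2_component 1" for \<rho>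
      proof -
        let ?\<sigma> = "\<lambda>v. M.ev \<rho> (\<phi> (var v))"
        \<comment> \<open>Uniqueness in the universal property identifies the composite with
          evaluation at its values on the variables.\<close>
        have eq: "(\<lambda>f. M.ev \<rho> (\<phi> f)) = M.ev ?\<sigma>"
        proof (rule M.eval_unique)
          show "Vector_Spaces.linear scaleJ scaleM (\<lambda>f. M.ev \<rho> (\<phi> f))"
            by unfold_locales (simp_all add: lin.add lin.scale M.eval_add M.eval_scale)
          show "M.ev \<rho> (\<phi> (f * g)) = jordan_prod (M.ev \<rho> (\<phi> f)) (M.ev \<rho> (\<phi> g))" for f g
            using \<phi> by (simp add: graded_endomorphism_def M.eval_mult)
          show "M.ev \<rho> (\<phi> 1) = mat 1"
            using \<phi> by (simp add: graded_endomorphism_def M.eval_one)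
        qed simp
        have "M.ev \<rho> (\<phi> g) \<in> UJ2_component d" if "g \<in> J_component d" for g d
          using \<rho> \<phi>_component[OF that]
          by (intro M.ev_component[OF UJ2_component_subspace UJ2_component_mult[OF two]
                UJ2_component_one[OF two]]) simp_all
        then have "M.ev ?\<sigma> f = 0"
          using f by (simp add: T_Cla_def J_component_yv J_component_zv)
        with fun_cong[OF eq, of f] show ?thesis by simp
      qed
      then show "\<phi> f \<in> T_Cla" by (simp add: T_Cla_def)
    qed
  next
    show "f * g \<in> T_Cla" "g * f \<in> T_Cla" if "f \<in> T_Cla" for f g :: "'k free_jordan"
      using that by (simp_all add: T_Cla_def M.eval_mult M.mul_zero_left M.mul_zero_right)
  qed
qed

text \<open>The hull is an intersection, and T-ideals are closed under intersections.\<close>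

lemma T_ideal_I_Cla: "T_ideal (I_Cla :: 'k::field free_jordan set)"
  unfolding I_Cla_def
proof (rule hull_in)
  fix \<F> :: "'k free_jordan set set"
  assume "Ball \<F> T_ideal"
  then have *: "T_ideal J" if "J \<in> \<F>" for J
    using that by blast
  show "T_ideal (\<Inter>\<F>)"
    unfolding T_ideal_def
  proof (intro conjI allI ballI impI)
    show "FJ.subspace (\<Inter>\<F>)"
      using * by (intro FJ.subspace_Inter) (simp add: T_ideal_def)
  next
    show "f * g \<in> \<Inter>\<F>" "g * f \<in> \<Inter>\<F>" if "f \<in> \<Inter>\<F>" for f g
      using that * by (simp_all add: T_ideal_def)
  next
    show "\<phi> ` \<Inter>\<F> \<subseteq> \<Inter>\<F>" if "graded_endomorphism \<phi>" for \<phi>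
    proof (intro image_subsetI InterI)
      fix f J assume "f \<in> \<Inter>\<F>" "J \<in> \<F>"
      then show "\<phi> f \<in> J"
        using *[of J] that by (simp add: T_ideal_def image_subset_iff)
    qed
  qed
qed

lemma I_Cla_gens: "associator (yv 0) (yv 1) (yv 2) \<in> I_Cla" "zv 0 * zv 1 \<in> I_Cla"
  "associator (yv 0) (zv 0) (yv 1) \<in> I_Cla"
  unfolding I_Cla_def by (auto intro: hull_inc)

text \<open>By minimality only the generators matter: diagonal matrices multiply entrywise, two
  multiples of \<open>matrix_unit 1 2\<close> have product 0, and diagonal matrices act on
  \<open>matrix_unit 1 2\<close> by scalars.\<close>

lemma I_Cla_subset_T_Cla:
  assumes two: "(2::'k::field) \<noteq> 0"
  shows "(I_Cla :: 'k free_jordan set) \<subseteq> T_Cla"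
  unfolding I_Cla_def
proof (rule hull_minimal)
  interpret M: unital_jordan_algebra scaleM jordan_prod "mat 1 :: 'k^2^2"
    by (rule unital_jordan_algebra_M2[OF two])
  have diff: "M.ev \<rho> (f - g) = M.ev \<rho> f - M.ev \<rho> g" for \<rho> f g
    using M.eval_add[of \<rho> "f - g" g] by (simp add: algebra_simps)
  note defs = jordan_prod_def scaleM_def vec_eq_iff forall_2 sum_2 matrix_matrix_mult_def
  show "{associator (yv 0) (yv 1) (yv 2), zv 0 * zv 1, associator (yv 0) (zv 0) (yv 1)}
      \<subseteq> (T_Cla :: 'k free_jordan set)"
    by (auto simp: T_Cla_def associator_def diff M.eval_mult M.eval_var UJ2_component_0[OF two]
        UJ2_component_1 defs algebra_simps)
qed (rule T_ideal_T_Cla[OF two])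

section \<open>Spanning\<close>

text \<open>Full polarisation of the Jordan identity in its three occurrences of \<open>x\<close>,
  arranged to divide by 2 only, so that characteristic 3 is covered.\<close>

lemma (in unital_jordan_algebra) jordan_linearized:
  assumes two: "(2::'k) \<noteq> 0"
  shows "mul (mul (mul a c) b) u + mul (mul (mul a u) b) c + mul (mul (mul c u) b) a =
    mul (mul a c) (mul b u) + mul (mul a u) (mul b c) + mul (mul c u) (mul b a)"
proof -
  \<comment> \<open>The defect of the Jordan identity for fixed \<open>b\<close>: trilinear,
    symmetric in its first two arguments and zero on the diagonal.\<close>
  define T where "T x w z = mul (mul (mul x w) b) z - mul (mul x w) (mul b z)" for x w z
  have T_add: "T (x + x') w z = T x w z + T x' w z" "T x (w + w') z = T x w z + T x w' z"
    "T x w (z + z') = T x w z + T x w z'" for x x' w w' z z'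
    by (simp_all add: T_def mul_distribs algebra_simps)
  have T_diff: "T (x - x') w z = T x w z - T x' w z" "T x (w - w') z = T x w z - T x w' z"
    "T x w (z - z') = T x w z - T x w z'" for x x' w w' z z'
    by (simp_all add: T_def mul_distribs algebra_simps)
  have T_comm: "T x w z = T w x z" for x w z
    by (simp add: T_def mul_commute[of x])
  have T_diag: "T x x x = 0" for x
    by (simp add: T_def jordan)
  have halve: "x = 0" if "x + x = 0" for x :: 'a
  proof -
    have "scale 2 x = 0"
      using that scale_left_distrib[of 1 1 x] by simp
    then show ?thesis using two by simp
  qed
  \<comment> \<open>The difference of the cubes at \<open>x + z\<close> and \<open>x - z\<close> is
    twice the part linear in \<open>z\<close> plus \<open>2 T z z z\<close>, and the last term
    vanishes.\<close>
  have partial: "T x x z + T x z x + T x z x = 0" for x z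
  proof (rule halve)
    have "T x x z + T x z x + T x z x + (T x x z + T x z x + T x z x) =
        T (x + z) (x + z) (x + z) - T (x - z) (x - z) (x - z)"
      by (simp add: T_add T_diff T_diag[of x] T_diag[of z] T_comm[of z x] algebra_simps)
    then show "T x x z + T x z x + T x z x + (T x x z + T x z x + T x z x) = 0"
      by (simp only: T_diag diff_self)
  qed
  have "T a c u + T a u c + T c u a = 0"
  proof (rule halve)
    \<comment> \<open>\<open>?P\<close> is quadratic in its argument; its polarisation at
      \<open>a\<close> and \<open>c\<close> is twice \<open>?S\<close>.\<close>
    let ?S = "T a c u + T a u c + T c u a" and ?P = "\<lambda>x. T x x u + T x u x + T x u x"
    have "?P (a + c) = ?P a + ?P c + (?S + ?S)"
      by (simp only: T_add T_comm[of c a] ac_simps)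
    then show "?S + ?S = 0"
      by (simp only: partial add_0_left)
  qed
  then show ?thesis
    by (simp add: T_def algebra_simps)
qed

section \<open>The quotient as a Jordan algebra\<close>

lemma I_Cla_mult:
  assumes "f \<in> I_Cla" shows "f * g \<in> I_Cla" "g * f \<in> I_Cla"
  using T_ideal_I_Cla assms unfolding T_ideal_def by blast+

instantiation J_mod_I :: (field) "{one, times}"
begin

lift_definition one_J_mod_I :: "'a J_mod_I" is 1 .
lift_definition times_J_mod_I :: "'a J_mod_I \<Rightarrow> 'a J_mod_I \<Rightarrow> 'a J_mod_I" is "(*)"
proof -
  fix f f' g g' :: "'a free_jordan"
  assume "f - f' \<in> I_Cla" "g - g' \<in> I_Cla"
  then have "(f - f') * g + f' * (g - g') \<in> I_Cla"
    by (intro FJ.subspace_add[OF subspace_I_Cla] I_Cla_mult)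
  then show "f * g - f' * g' \<in> I_Cla"
    by (simp add: FJ.mul_distribs)
qed

instance ..

end

lemma coset_one: "coset 1 = 1"
  by (simp add: coset_def one_J_mod_I.abs_eq)

lemma coset_zero: "coset 0 = 0"
  by (simp add: coset_def zero_J_mod_I.abs_eq)

lemma coset_mult: "coset (f * g) = coset f * coset g"
  by (simp add: coset_def times_J_mod_I.abs_eq)

lemma coset_surj: "\<exists>f. coset f = q"
  unfolding coset_def by (induction q) blast

global_interpretation QJ: unital_jordan_algebra scaleQ "(*)" "1 :: 'k::field J_mod_I"
proof
  fix p q r :: "'k J_mod_I" and c :: 'k
  obtain f g h where [simp]: "p = coset f" "q = coset g" "r = coset h"
    using coset_surj by metis
  show "p * q = q * p"
    by (simp add: FJ.mul_commute flip: coset_mult)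
  show "(p + q) * r = p * r + q * r"
    by (simp add: FJ.mul_add_left flip: coset_mult coset_add)
  show "scaleQ c p * q = scaleQ c (p * q)"
    by (simp add: FJ.mul_scale_left flip: coset_mult coset_scale)
  show "1 * p = p"
    by (simp add: FJ.mul_unit flip: coset_mult coset_one)
  show "p * p * q * p = p * p * (q * p)"
    by (simp add: FJ.jordan flip: coset_mult)
qed

section \<open>Relations between even and odd elements of the quotient\<close>

lemma I_Cla_subst:
  fixes f :: "'k::field free_jordan"
  assumes "f \<in> I_Cla" "\<And>i. \<rho> (Y i) \<in> J_component 0" "\<And>i. \<rho> (Z i) \<in> J_component 1"
  shows "FJ.ev \<rho> f \<in> I_Cla"
proof -
  have "FJ.ev \<rho> ` I_Cla \<subseteq> I_Cla"
    using T_ideal_I_Cla[where 'k = 'k] graded_endomorphism_eval[OF assms(2,3)]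
    by (simp add: T_ideal_def)
  then show ?thesis using assms(1) by blast
qed

lemma ev_diff: "FJ.ev \<rho> (f - g) = FJ.ev \<rho> f - FJ.ev \<rho> g"
  using FJ.eval_add[of \<rho> "f - g" g] by (simp add: algebra_simps)

lemma coset_associator:
  "coset f * coset g * coset h = coset f * (coset g * coset h) \<longleftrightarrow> associator f g h \<in> I_Cla"
  by (simp add: coset_eq_iff associator_def flip: coset_mult)

definition even_part :: "'k::field J_mod_I set" where
  "even_part = coset ` J_component 0"

definition odd_part :: "'k::field J_mod_I set" where
  "odd_part = coset ` J_component 1"

text \<open>Stability of the ideal under graded endomorphisms turns the generator, a relation
  between variables, into one between arbitrary even elements.\<close>

lemma even_assoc:
  assumes "a \<in> even_part" "b \<in> even_part" "c \<in> even_part"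
  shows "a * b * c = a * (b * c)"
proof -
  obtain f g h where fgh: "a = coset f" "b = coset g" "c = coset h"
    "f \<in> J_component 0" "g \<in> J_component 0" "h \<in> J_component 0"
    using assms by (auto simp: even_part_def)
  \<comment> \<open>The substitution must be graded on all variables; the odd ones go to 0, which
    lies in every component.\<close>
  define \<rho> where "\<rho> = case_jvar (\<lambda>i. if i = 0 then f else if i = 1 then g else h) (\<lambda>_. 0)"
  have "FJ.ev \<rho> (associator (yv 0) (yv 1) (yv 2)) \<in> I_Cla"
    using fgh by (intro I_Cla_subst I_Cla_gens)
      (simp_all add: \<rho>_def FJ.subspace_0[OF J_component_subspace])
  then show ?thesis
    by (simp add: fgh coset_associator) (simp add: associator_def ev_diff FJ.eval_mult FJ.eval_var \<rho>_def)
qed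

lemma odd_mult_odd:
  assumes "u \<in> odd_part" "v \<in> odd_part"
  shows "u * v = 0"
proof -
  obtain f g where fg: "u = coset f" "v = coset g" "f \<in> J_component 1" "g \<in> J_component 1"
    using assms by (auto simp: odd_part_def)
  define \<rho> where "\<rho> = case_jvar (\<lambda>_. 0) (\<lambda>i. if i = 0 then f else g)"
  have "FJ.ev \<rho> (zv 0 * zv 1) \<in> I_Cla"
    using fg by (intro I_Cla_subst I_Cla_gens)
      (simp_all add: \<rho>_def FJ.subspace_0[OF J_component_subspace])
  then have "coset (f * g) = coset 0"
    by (simp add: coset_eq_iff FJ.eval_mult FJ.eval_var \<rho>_def)
  then show ?thesis
    by (simp add: fg coset_mult coset_zero)
qed

text \<open>By commutativity of the product, vanishing of the associator of \<open>a\<close>,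
  \<open>u\<close>, \<open>b\<close> says that multiplications by \<open>a\<close> and
  \<open>b\<close> commute on \<open>u\<close>.\<close>

lemma even_odd_commute:
  assumes "a \<in> even_part" "u \<in> odd_part" "b \<in> even_part"
  shows "a * (b * u) = b * (a * u)"
proof -
  obtain f g h where fgh: "a = coset f" "u = coset g" "b = coset h"
    "f \<in> J_component 0" "g \<in> J_component 1" "h \<in> J_component 0"
    using assms by (auto simp: even_part_def odd_part_def)
  define \<rho> where "\<rho> = case_jvar (\<lambda>i. if i = 0 then f else h) (\<lambda>_. g)"
  have "FJ.ev \<rho> (associator (yv 0) (zv 0) (yv 1)) \<in> I_Cla"
    using fgh by (intro I_Cla_subst I_Cla_gens) (simp_all add: \<rho>_def)
  then have "a * u * b = a * (u * b)"
    by (simp add: fgh coset_associator) (simp add: associator_def ev_diff FJ.eval_mult FJ.eval_var \<rho>_def)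
  then show ?thesis
    by (simp add: QJ.mul_commute)
qed

lemma even_mult_odd: "a \<in> even_part \<Longrightarrow> u \<in> odd_part \<Longrightarrow> a * u \<in> odd_part"
  using J_component_mult[of _ 0 _ 1]
  by (auto simp: even_part_def odd_part_def coset_mult[symmetric] intro!: imageI)

text \<open>Two of the nested products in the linearised Jordan identity equal the left-hand side
  because even multiplications commute on \<open>u\<close>. The third is a single multiplication by
  \<open>a * c * b\<close> and moves to the right.\<close>

lemma triple_reduction:
  assumes two: "(2::'k::field) \<noteq> 0"
    and ev: "a \<in> even_part" "b \<in> even_part" "c \<in> even_part" and u: "(u :: 'k J_mod_I) \<in> odd_part"
  shows "c * (a * (b * u)) =
    scaleQ (1/2) ((a * c) * (b * u) + (b * c) * (a * u) + (a * b) * (c * u) - (a * c * b) * u)"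
proof -
  let ?t = "c * (a * (b * u))"
  have comm: "c * (b * (a * u)) = ?t" "a * (b * (c * u)) = ?t"
    by (metis ev u even_odd_commute even_mult_odd)+
  have "a * c * b * u + c * (b * (a * u)) + a * (b * (c * u)) =
      (a * c) * (b * u) + (b * c) * (a * u) + (a * b) * (c * u)"
    using QJ.jordan_linearized[OF two, of a c b u]
    by (simp add: QJ.mul_commute)
  then have "?t + ?t =
      (a * c) * (b * u) + (b * c) * (a * u) + (a * b) * (c * u) - (a * c * b) * u"
    unfolding comm by (simp add: algebra_simps)
  moreover have "scaleQ (1/2) (?t + ?t) = ?t"
  proof -
    have "scaleQ (1/2) (?t + ?t) = scaleQ (1/2 + 1/2) ?t"
      by (simp only: Q.scale_right_distrib Q.scale_left_distrib)
    also have "(1/2 + 1/2 :: 'k) = 1"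
      using two by simp
    finally show ?thesis by simp
  qed
  ultimately show ?thesis by simp
qed

section \<open>Monomials modulo the ideal and the span of \<open>S_Cla\<close>\<close>

lemma ymon_Nil: "ymon [] = 1"
  by (simp add: ymon_def)

lemma ymon_snoc: "ymon (ms @ [n]) = ymon ms * yv n"
  by (simp add: ymon_def)

lemma ymon_single: "ymon [n] = yv n"
  using ymon_snoc[of "[]" n] by (simp add: ymon_Nil FJ.mul_unit)

lemma coset_ymon_even: "coset (ymon ms :: 'k::field free_jordan) \<in> even_part"
proof -
  have "(ymon ms :: 'k free_jordan) \<in> J_component 0"
  proof (induction ms rule: rev_induct)
    case Nil
    then show ?case by (simp add: ymon_Nil J_component_one)
  next
    case (snoc m ms)
    then show ?case
      using J_component_mult[OF _ J_component_yv] by (fastforce simp: ymon_snoc)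
  qed
  then show ?thesis by (simp add: even_part_def)
qed

lemma coset_zv_odd: "coset (zv i) \<in> odd_part"
  by (simp add: odd_part_def J_component_zv)

lemma coset_ymon_append:
  "(coset (ymon (ms @ ns)) :: 'k::field J_mod_I) = coset (ymon ms) * coset (ymon ns)"
proof (induction ns rule: rev_induct)
  case Nil
  show ?case by (simp add: ymon_Nil coset_one QJ.mul_commute[of _ 1] QJ.mul_unit)
next
  case (snoc n ns)
  let ?q = "\<lambda>ms. coset (ymon ms) :: 'k J_mod_I"
  have "?q (ms @ ns @ [n]) = ?q ms * ?q ns * ?q [n]"
    using snoc by (simp add: coset_mult ymon_single ymon_snoc flip: append_assoc)
  also have "\<dots> = ?q ms * (?q ns * ?q [n])"
    by (intro even_assoc coset_ymon_even)
  also have "?q ns * ?q [n] = ?q (ns @ [n])"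
    by (simp add: coset_mult ymon_single ymon_snoc)
  finally show ?case .
qed

lemma coset_ymon_Cons:
  "(coset (ymon (m # ms)) :: 'k::field J_mod_I) = coset (ymon [m]) * coset (ymon ms)"
  using coset_ymon_append[of "[m]" ms] by simp

lemma coset_ymon_insort:
  "(coset (ymon (insort m ms)) :: 'k::field J_mod_I) = coset (ymon (m # ms))"
proof (induction ms)
  case (Cons n ms)
  let ?q = "\<lambda>ms. coset (ymon ms) :: 'k J_mod_I"
  have "?q [n] * (?q [m] * ?q ms) = ?q [n] * ?q [m] * ?q ms"
    by (intro even_assoc[symmetric] coset_ymon_even)
  also have "\<dots> = ?q [m] * (?q [n] * ?q ms)"
    unfolding QJ.mul_commute[of "?q [n]" "?q [m]"] by (intro even_assoc coset_ymon_even)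
  finally show ?case
    using Cons by (simp add: coset_ymon_Cons[of _ "insort m ms"] coset_ymon_Cons[of _ "_ # _"]
        coset_ymon_Cons[of _ ms])
qed simp

lemma coset_ymon_sort: "(coset (ymon (sort ms)) :: 'k::field J_mod_I) = coset (ymon ms)"
proof (induction ms)
  case (Cons m ms)
  have "(coset (ymon (sort (m # ms))) :: 'k J_mod_I) = coset (ymon (m # sort ms))"
    by (simp add: coset_ymon_insort)
  also have "\<dots> = coset (ymon (m # ms))"
    by (simp only: coset_ymon_Cons[of m "sort ms"] coset_ymon_Cons[of m ms] Cons)
  finally show ?case .
qed simp

text \<open>Both lists can be sorted in the quotient, and the two even factors can be exchanged, so
  totality of \<open>index_le\<close> puts them in the required order.\<close>

lemma odd_mon_in_span:
  "coset (ymon ms) * (coset (zv i) * coset (ymon ns)) \<in>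
    Q.span (coset ` (S_Cla :: 'k::field free_jordan set))"
proof -
  let ?q = "\<lambda>ms. coset (ymon ms) :: 'k J_mod_I"
  have *: "?q ms * (coset (zv i) * ?q ns) \<in> Q.span (coset ` S_Cla)"
    if "sorted ms" "sorted ns" "index_le ms ns" for ms ns
  proof -
    have "(ymon ms * (zv i * ymon ns) :: 'k free_jordan) \<in> S_Cla"
      unfolding S_Cla_def using that by blast
    then show ?thesis
      by (intro Q.span_base) (auto simp flip: coset_mult)
  qed
  have swap: "?q ms * (coset (zv i) * ?q ns) = ?q ns * (coset (zv i) * ?q ms)" for ms ns
    using even_odd_commute[OF coset_ymon_even coset_zv_odd coset_ymon_even]
    by (simp only: QJ.mul_commute[of "coset (zv i)"])
  have "?q (sort ms) * (coset (zv i) * ?q (sort ns)) \<in> Q.span (coset ` S_Cla)"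
    using index_le_total[of "sort ms" "sort ns"] *[of "sort ms" "sort ns"]
      *[of "sort ns" "sort ms"] swap[of "sort ms" "sort ns"] by auto
  then show ?thesis by (simp only: coset_ymon_sort)
qed

lemma even_mon_in_span:
  "coset (ymon ms) \<in> Q.span (coset ` (S_Cla :: 'k::field free_jordan set))"
proof -
  have "(ymon (sort ms) :: 'k free_jordan) \<in> S_Cla"
    unfolding S_Cla_def by (intro UnI1 CollectI exI[of _ "sort ms"] conjI HOL.refl sorted_sort)
  then have "coset (ymon (sort ms) :: 'k free_jordan) \<in> Q.span (coset ` S_Cla)"
    by (intro Q.span_base imageI)
  then show ?thesis by (simp only: coset_ymon_sort)
qed

text \<open>\<open>triple_reduction\<close> leaves at most two even factors on the odd variable,
  each again a monomial in the even variables.\<close>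

lemma ymon_mult_odd_mon_in_span:
  assumes two: "(2::'k::field) \<noteq> 0"
  shows "coset (ymon ls) * (coset (ymon ms) * (coset (zv i) * coset (ymon ns)))
    \<in> Q.span (coset ` (S_Cla :: 'k free_jordan set))"
proof -
  let ?q = "\<lambda>ms. coset (ymon ms) :: 'k J_mod_I" and ?z = "coset (zv i) :: 'k J_mod_I"
  have double: "?q ms * (?q ns * ?z) \<in> Q.span (coset ` S_Cla)" for ms ns
    unfolding QJ.mul_commute[of "?q ns" ?z] by (rule odd_mon_in_span)
  have single: "?q ms * ?z \<in> Q.span (coset ` S_Cla)" for ms
    using double[of ms "[]"] by (simp add: ymon_Nil coset_one QJ.mul_unit)
  have "?q ls * (?q ms * (?q ns * ?z)) \<in> Q.span (coset ` S_Cla)"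
    unfolding triple_reduction[OF two coset_ymon_even coset_ymon_even coset_ymon_even coset_zv_odd]
      coset_ymon_append[symmetric]
    by (intro Q.span_scale Q.span_add Q.span_diff double single)
  then show ?thesis
    by (simp only: QJ.mul_commute[of ?z "?q ns"])
qed

lemma S_Cla_mult_in_span:
  assumes two: "(2::'k::field) \<noteq> 0" and "f \<in> S_Cla" "g \<in> S_Cla"
  shows "coset f * coset g \<in> Q.span (coset ` (S_Cla :: 'k free_jordan set))"
proof -
  have cases: "(\<exists>ms. h = ymon ms) \<or> (\<exists>ms i ns. h = ymon ms * (zv i * ymon ns))"
    if "h \<in> S_Cla" for h :: "'k free_jordan"
    using that by (auto simp: S_Cla_def)
  have odd: "coset (ymon ms * (zv i * ymon ns)) \<in> odd_part" for ms i ns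
    by (simp only: coset_mult QJ.mul_commute[of "coset (zv i)"] even_mult_odd coset_ymon_even
        coset_zv_odd)
  show ?thesis
    using cases[OF assms(2)] cases[OF assms(3)]
  proof (elim disjE exE)
    fix ms ns assume "f = ymon ms" "g = ymon ns"
    then show ?thesis
      using even_mon_in_span by (simp flip: coset_ymon_append)
  next
    fix ls ms i ns assume "f = ymon ls" "g = ymon ms * (zv i * ymon ns)"
    then show ?thesis
      using ymon_mult_odd_mon_in_span[OF two] by (simp add: coset_mult)
  next
    fix ls ms i ns assume "g = ymon ls" "f = ymon ms * (zv i * ymon ns)"
    then show ?thesis
      using ymon_mult_odd_mon_in_span[OF two] by (simp add: coset_mult QJ.mul_commute[of _ "coset (ymon ls)"])
  next
    fix ms i ns ms' i' ns'
    assume "f = ymon ms * (zv i * ymon ns)" "g = ymon ms' * (zv i' * ymon ns')"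
    then have "coset f * coset g = 0"
      using odd by (intro odd_mult_odd) simp_all
    then show ?thesis by (simp add: Q.span_zero)
  qed
qed

text \<open>The span contains 1 and all variables and is closed under the algebra operations, so
  induction on a representing term applies.\<close>

lemma coset_in_span_S_Cla:
  assumes two: "(2::'k::field) \<noteq> 0"
  shows "coset (f :: 'k free_jordan) \<in> Q.span (coset ` S_Cla)"
proof (induction f)
  fix t :: "'k jterm"
  show "coset (abs_free_jordan t) \<in> Q.span (coset ` S_Cla)"
  proof (induction t)
    case (Var v)
    show ?case
    proof (cases v)
      case (Y i)
      then show ?thesis
        using even_mon_in_span[of "[i]"] by (simp add: ymon_single var.abs_eq)
    next
      case (Z i)
      then show ?thesis
        using odd_mon_in_span[of "[]" i "[]"]
        by (simp add: ymon_Nil coset_one QJ.mul_unit QJ.mul_commute[of _ 1] var.abs_eq)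
    qed
  next
    case Zero
    then show ?case
      by (simp add: coset_zero Q.span_zero flip: zero_free_jordan.abs_eq)
  next
    case One
    then show ?case
      using even_mon_in_span[of "[]"] by (simp add: ymon_Nil flip: one_free_jordan.abs_eq)
  next
    case (Add s t)
    then show ?case
      by (simp add: coset_add Q.span_add flip: plus_free_jordan.abs_eq)
  next
    case (Scale c s)
    then show ?case
      by (simp add: coset_scale Q.span_scale flip: scaleJ.abs_eq)
  next
    case (Mul s t)
    have "coset (abs_free_jordan s) * coset (abs_free_jordan t) \<in> Q.span (coset ` S_Cla)"
      using S_Cla_mult_in_span[OF two]
      by (intro QJ.mul_span[OF _ Q.subspace_span Mul]) blast
    then show ?case
      by (simp add: coset_mult flip: times_free_jordan.abs_eq)
  qed
qed

section \<open>Linear independence modulo the graded identities\<close>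

definition diag2 :: "'k::field \<Rightarrow> 'k \<Rightarrow> 'k^2^2" where
  "diag2 x y = (\<chi> r s. if r = s then if r = 1 then x else y else 0)"

lemma jordan_prod_diag2:
  assumes "(2::'k::field) \<noteq> 0"
  shows "jordan_prod (diag2 x y) (diag2 x' y') = diag2 (x * x') (y * (y'::'k))"
proof -
  have "a * b / 2 + a * b / 2 = a * b" for a b :: 'k
    using assms by (simp add: field_simps)
  then show ?thesis
    by (simp add: jordan_prod_def scaleM_def vec_eq_iff forall_2 sum_2 matrix_matrix_mult_def
        diag2_def algebra_simps)
qed

text \<open>The left action by \<open>x\<close> and the right action by \<open>y\<close> are
  averaged; these averages produce the symmetric products treated above.\<close>

lemma jordan_prod_diag2_unit:
  "jordan_prod (diag2 x y) (scaleM e (matrix_unit 1 2)) = scaleM ((x + y) / 2 * e) (matrix_unit 1 2)"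
  by (simp add: jordan_prod_def scaleM_def vec_eq_iff forall_2 sum_2 matrix_matrix_mult_def
      diag2_def matrix_unit_def algebra_simps)

text \<open>The scalars \<open>e\<close> are kept free so that an indicator function can isolate one
  odd variable.\<close>

definition graded_subst ::
  "(nat \<Rightarrow> 'k::field) \<Rightarrow> (nat \<Rightarrow> 'k) \<Rightarrow> (nat \<Rightarrow> 'k) \<Rightarrow> jvar \<Rightarrow> 'k^2^2" where
  "graded_subst a b e = case_jvar (\<lambda>i. diag2 (a i) (b i)) (\<lambda>i. scaleM (e i) (matrix_unit 1 2))"

text \<open>Coefficients are attached to indices, not to elements, so that independence of the
  family also yields injectivity of \<open>coset\<close> on \<open>S_Cla\<close>.\<close>

type_synonym index = "nat list + nat \<times> nat list \<times> nat list"

definition basis_elem :: "index \<Rightarrow> 'k::field free_jordan" where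
  "basis_elem = case_sum ymon (\<lambda>(i, ms, ns). ymon ms * (zv i * ymon ns))"

definition basis_index :: "index set" where
  "basis_index = {ms. sorted ms} <+> {(i, ms, ns). sorted ms \<and> sorted ns \<and> index_le ms ns}"

lemma S_Cla_eq: "S_Cla = basis_elem ` basis_index"
proof
  show "S_Cla \<subseteq> basis_elem ` basis_index"
  proof
    fix f :: "'k::field free_jordan"
    assume "f \<in> S_Cla"
    then consider ms where "f = ymon ms" "sorted ms"
      | i ms ns where "f = ymon ms * (zv i * ymon ns)" "sorted ms" "sorted ns" "index_le ms ns"
      by (auto simp: S_Cla_def)
    then show "f \<in> basis_elem ` basis_index"
    proof cases
      case 1
      then show ?thesis
        by (intro image_eqI[of _ _ "Inl ms"]) (auto simp: basis_elem_def basis_index_def)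
    next
      case 2
      then show ?thesis
        by (intro image_eqI[of _ _ "Inr (i, ms, ns)"]) (auto simp: basis_elem_def basis_index_def)
    qed
  qed
  show "basis_elem ` basis_index \<subseteq> S_Cla"
    by (auto simp: basis_elem_def basis_index_def S_Cla_def)
qed

lemma T_Cla_independent:
  fixes c :: "index \<Rightarrow> 'k::field"
  assumes inf: "infinite (UNIV :: 'k set)" and two: "(2::'k) \<noteq> 0"
    and fin: "finite G" and G: "G \<subseteq> basis_index"
    and T: "(\<Sum>t\<in>G. c t *\<^sub>J basis_elem t) \<in> T_Cla"
  shows "\<forall>t\<in>G. c t = 0"
proof -
  interpret M: unital_jordan_algebra scaleM jordan_prod "mat 1 :: 'k^2^2"
    by (rule unital_jordan_algebra_M2[OF two])
  have ev_ymon: "M.ev (graded_subst a b e) (ymon ms) = diag2 (mon_fun a ms) (mon_fun b ms)" for a b e ms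
  proof (induction ms rule: rev_induct)
    case Nil
    have "M.ev (graded_subst a b e) (ymon []) = mat 1"
      by (simp only: ymon_Nil M.eval_one)
    also have "mat 1 = diag2 (mon_fun a []) (mon_fun b [])"
      by (simp add: diag2_def mat_def vec_eq_iff)
    finally show ?case .
  next
    case (snoc m ms)
    then show ?case
      by (simp add: ymon_snoc M.eval_mult M.eval_var graded_subst_def jordan_prod_diag2[OF two])
  qed
  have ev_odd: "M.ev (graded_subst a b e) (ymon ms * (zv i * ymon ns)) =
      scaleM ((mon_fun a ms + mon_fun b ms) / 2 * ((mon_fun a ns + mon_fun b ns) / 2 * e i))
        (matrix_unit 1 2)" for a b e ms i ns
  proof -
    have "M.ev (graded_subst a b e) (zv i) = scaleM (e i) (matrix_unit 1 2)"
      by (simp add: M.eval_var graded_subst_def)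
    then show ?thesis
      by (simp only: M.eval_mult ev_ymon jordan_prod_diag2_unit
          M.mul_commute[of "scaleM _ _" "diag2 _ _"])
  qed
  have ev_sum: "M.ev \<rho> (\<Sum>t\<in>G. c t *\<^sub>J basis_elem t) =
      (\<Sum>t\<in>G. scaleM (c t) (M.ev \<rho> (basis_elem t)))" for \<rho>
  proof -
    have "M.ev \<rho> 0 = 0"
      using M.eval_add[of \<rho> 0 0] by simp
    with fin show ?thesis
      by (induction G rule: finite_induct) (simp_all add: M.eval_add M.eval_scale)
  qed
  have entry: "(\<Sum>t\<in>G. c t * M.ev (graded_subst a b e) (basis_elem t) $ r $ s) = 0" for a b e r s
  proof -
    have "graded_subst a b e (Y i) \<in> UJ2_component 0" "graded_subst a b e (Z i) \<in> UJ2_component 1" for i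
      by (simp_all add: graded_subst_def UJ2_component_0[OF two] UJ2_component_1 diag2_def scaleM_def
          matrix_unit_def)
    then have "M.ev (graded_subst a b e) (\<Sum>t\<in>G. c t *\<^sub>J basis_elem t) = 0"
      using T by (simp add: T_Cla_def)
    then have "(\<Sum>t\<in>G. scaleM (c t) (M.ev (graded_subst a b e) (basis_elem t))) $ r $ s = 0"
      unfolding ev_sum by simp
    then show ?thesis
      by (simp add: sum_component scaleM_def)
  qed
  define G1 where "G1 = Inl -` G"
  define G2 where "G2 = Inr -` G"
  have fin12: "finite G1" "finite G2"
    using fin by (simp_all add: G1_def G2_def finite_vimageI)
  have "G = G1 <+> G2"
  proof (intro set_eqI iffI)
    show "t \<in> G1 <+> G2" if "t \<in> G" for t
      using that by (cases t) (auto simp: G1_def G2_def)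
  qed (auto simp: G1_def G2_def)
  then have split: "sum h G = (\<Sum>ms\<in>G1. h (Inl ms)) + (\<Sum>q\<in>G2. h (Inr q))" for h :: "_ \<Rightarrow> 'k"
    by (simp add: sum.Plus fin12)
  \<comment> \<open>In entry (1,1) all elements with an odd variable vanish. Pairing
    \<open>ms\<close> with the empty list makes the factor in \<open>b\<close> equal to 1.\<close>
  have c1: "c (Inl ms) = 0" if "ms \<in> G1" for ms
  proof -
    have "\<forall>p\<in>(\<lambda>ms. (ms, [] :: nat list)) ` G1. c (Inl (fst p)) = 0"
    proof (rule mon_fun_independent[OF inf])
      fix a b :: "nat \<Rightarrow> 'k"
      have "(\<Sum>ms\<in>G1. c (Inl ms) * mon_fun a ms) = 0"
        using entry[of a b "\<lambda>_. 0" 1 1]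
        by (simp add: split basis_elem_def ev_ymon ev_odd diag2_def scaleM_def matrix_unit_def case_prod_beta)
      then show "(\<Sum>(p, q)\<in>(\<lambda>ms. (ms, [])) ` G1.
          c (Inl (fst (p, q))) * (mon_fun a p * mon_fun b q)) = 0"
        by (subst sum.reindex) (auto simp: inj_on_def)
    qed (use fin12 G in \<open>auto simp: G1_def basis_index_def\<close>)
    with that show ?thesis by simp
  qed
  \<comment> \<open>Entry (1,2) sees only elements with an odd variable; \<open>H\<close> collects
    the pairs of lists belonging to \<open>zv i\<close>, which \<open>?e\<close> singles
    out.\<close>
  have c2: "c (Inr (i, ms, ns)) = 0" if "(i, ms, ns) \<in> G2" for i ms ns
  proof -
    define H where "H = Pair i -` G2"
    have "finite H"
      using fin12 by (auto simp: H_def intro: finite_vimageI injI)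
    have "\<forall>p\<in>H. c (Inr (i, p)) = 0"
    proof (rule symmetric_products_independent[OF inf two \<open>finite H\<close>])
      show "sorted m \<and> sorted n \<and> index_le m n" if "(m, n) \<in> H" for m n
        using that G by (auto simp: H_def G2_def basis_index_def)
      fix a b :: "nat \<Rightarrow> 'k"
      let ?e = "\<lambda>j. if j = i then 1 else 0 :: 'k"
      let ?h = "\<lambda>p. (mon_fun a (fst p) + mon_fun b (fst p)) * (mon_fun a (snd p) + mon_fun b (snd p))"
      have "0 = (\<Sum>q\<in>G2. c (Inr q) * (?h (snd q) / 4 * ?e (fst q)))"
        using entry[of a b ?e 1 2]
        by (simp add: split basis_elem_def ev_ymon ev_odd diag2_def scaleM_def matrix_unit_def
            case_prod_beta c1 mult.assoc)
      also have "\<dots> = (\<Sum>q\<in>Pair i ` H. c (Inr q) * (?h (snd q) / 4 * ?e (fst q)))"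
        by (rule sum.mono_neutral_right) (auto simp: fin12 H_def)
      also have "\<dots> = (\<Sum>p\<in>H. c (Inr (i, p)) * ?h p / 4)"
        by (subst sum.reindex) (auto simp: inj_on_def)
      also have "\<dots> = (\<Sum>p\<in>H. c (Inr (i, p)) * ?h p) / 4"
        by (simp add: sum_divide_distrib)
      finally have "(\<Sum>p\<in>H. c (Inr (i, p)) * ?h p) = 0"
        using four_neq_zero[OF two] by simp
      then show "(\<Sum>(m, n)\<in>H. c (Inr (i, m, n)) *
          ((mon_fun a m + mon_fun b m) * (mon_fun a n + mon_fun b n))) = 0"
        by (simp add: case_prod_beta)
    qed
    with that show ?thesis by (simp add: H_def)
  qed
  show ?thesis
  proof
    fix t assume "t \<in> G"
    then show "c t = 0"
      using c1 c2 by (cases t) (auto simp: G1_def G2_def)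
  qed
qed

section \<open>Equality of the ideals and the basis of the quotient\<close>

lemma coset_sum: "coset (\<Sum>t\<in>G. c t *\<^sub>J f t) = (\<Sum>t\<in>G. scaleQ (c t) (coset (f t)))"
  by (induction G rule: infinite_finite_induct) (simp_all add: coset_zero coset_add coset_scale)

theorem theorem5p7:
  assumes "infinite (UNIV :: 'k::field set)" and "CHAR('k) \<noteq> 2"
  shows "(I_Cla :: 'k free_jordan set) = T_Cla \<and>
    inj_on coset (S_Cla :: 'k free_jordan set) \<and>
    Q.independent (coset ` (S_Cla :: 'k free_jordan set)) \<and>
    Q.span (coset ` (S_Cla :: 'k free_jordan set)) = UNIV"
proof -
  have two: "(2::'k) \<noteq> 0"
  proof
    assume "(2::'k) = 0"
    then have "CHAR('k) dvd 2"
      using of_nat_eq_0_iff_char_dvd[where 'a = 'k, of 2] by simp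
    \<comment> \<open>The divisors of 2 are 1 and 2, and characteristic 1 would force
      \<open>1 = 0\<close>.\<close>
    then have "CHAR('k) = 1"
      using assms(2) two_is_prime_nat by (auto simp: prime_nat_iff)
    then show False
      using of_nat_CHAR[where 'a = 'k] by simp
  qed
  let ?b = "\<lambda>t. coset (basis_elem t) :: 'k J_mod_I"
  have indep: "\<forall>t\<in>G. c t = 0"
    if "finite G" "G \<subseteq> basis_index" "(\<Sum>t\<in>G. scaleQ (c t) (?b t)) = 0" for G and c :: "index \<Rightarrow> 'k"
  proof -
    have "(\<Sum>t\<in>G. c t *\<^sub>J basis_elem t) \<in> (I_Cla :: 'k free_jordan set)"
      using that(3) coset_eq_iff[of "\<Sum>t\<in>G. c t *\<^sub>J basis_elem t" 0]
      by (simp add: coset_sum coset_zero)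
    then show ?thesis
      using T_Cla_independent[OF assms(1) two that(1,2)] I_Cla_subset_T_Cla[OF two] by blast
  qed
  have inj: "inj_on ?b basis_index"
  proof (rule inj_onI, rule ccontr)
    fix s t assume st: "s \<in> basis_index" "t \<in> basis_index" "?b s = ?b t" "s \<noteq> t"
    \<comment> \<open>Equal cosets of distinct indices give a relation with coefficients 1 and
      -1.\<close>
    then have "(\<Sum>u\<in>{s, t}. scaleQ (if u = s then 1 else -1) (?b u)) = 0"
      by simp
    then show False
      using indep[of "{s, t}" "\<lambda>u. if u = s then 1 else -1"] st by simp
  qed
  have S: "coset ` S_Cla = ?b ` basis_index"
    by (simp add: S_Cla_eq image_image)
  have "Q.independent (?b ` basis_index)"
    unfolding Q.dependent_explicit
  proof safe
    fix A u v
    assume A: "finite A" "A \<subseteq> ?b ` basis_index" "(\<Sum>v\<in>A. scaleQ (u v) v) = 0"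
      and v: "v \<in> A" "u v \<noteq> 0"
    obtain G where G: "G \<subseteq> basis_index" "A = ?b ` G"
      using A(2) by (auto simp: subset_image_iff)
    have injG: "inj_on ?b G"
      using inj G(1) by (rule inj_on_subset)
    then have "finite G"
      using A(1) G(2) by (simp add: finite_image_iff)
    have "(\<Sum>t\<in>G. scaleQ (u (?b t)) (?b t)) = 0"
      using A(3) by (simp add: G(2) sum.reindex[OF injG])
    then have "\<forall>t\<in>G. u (?b t) = 0"
      using indep[OF \<open>finite G\<close> G(1), of "\<lambda>t. u (?b t)"] by simp
    then show False
      using v G(2) by auto
  qed
  moreover have "inj_on coset (S_Cla :: 'k free_jordan set)"
    using inj by (auto simp: S_Cla_eq inj_on_def)
  \<comment> \<open>Modulo the ideal, \<open>f\<close> equals a combination \<open>g\<close> of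
    elements of \<open>S_Cla\<close>. Then \<open>g\<close> is an identity too, so its coefficients
    vanish, and \<open>f\<close> lies in the ideal.\<close>
  moreover have "T_Cla \<subseteq> (I_Cla :: 'k free_jordan set)"
  proof
    fix f :: "'k free_jordan"
    assume f: "f \<in> T_Cla"
    have "coset f \<in> Q.span (?b ` basis_index)"
      using coset_in_span_S_Cla[OF two] by (simp add: S)
    then obtain A r where A: "finite A" "A \<subseteq> ?b ` basis_index" "coset f = (\<Sum>v\<in>A. scaleQ (r v) v)"
      unfolding Q.span_explicit by blast
    obtain G where G: "G \<subseteq> basis_index" "A = ?b ` G"
      using A(2) by (auto simp: subset_image_iff)
    have injG: "inj_on ?b G"
      using inj G(1) by (rule inj_on_subset)
    then have "finite G"
      using A(1) G(2) by (simp add: finite_image_iff)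
    define g where "g = (\<Sum>t\<in>G. r (?b t) *\<^sub>J basis_elem t)"
    have eq: "coset f = coset g"
      using A(3) by (simp add: g_def coset_sum G(2) sum.reindex[OF injG])
    then have "f - g \<in> T_Cla"
      using I_Cla_subset_T_Cla[OF two] by (auto simp: coset_eq_iff)
    moreover have "FJ.subspace (T_Cla :: 'k free_jordan set)"
      using T_ideal_T_Cla[OF two] by (simp add: T_ideal_def)
    ultimately have "g \<in> T_Cla"
      using FJ.subspace_diff[OF _ f, of "f - g"] by (simp only: diff_diff_eq2 add_diff_cancel_left')
    then have "\<forall>t\<in>G. r (?b t) = 0"
      using T_Cla_independent[OF assms(1) two \<open>finite G\<close> G(1), of "\<lambda>t. r (?b t)"]
      by (simp add: g_def)
    then have "g = 0" by (simp add: g_def)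
    with eq show "f \<in> I_Cla" by (simp add: coset_eq_iff)
  qed
  moreover have "Q.span (coset ` S_Cla) = (UNIV :: 'k J_mod_I set)"
    using coset_in_span_S_Cla[OF two] coset_surj by (metis UNIV_eq_I)
  ultimately show ?thesis
    using I_Cla_subset_T_Cla[OF two] by (simp add: S)
qed

end
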